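(* Let $A \in \mathbb{C}^{n\times n}$ be Schur stable, $B\in\mathbb{C}^{n\times m}$, $C\in\mathbb{C}^{l\times n}$, $D\in\mathbb{C}^{l\times m}$, and let $0<\theta_0<\pi$. Consider the semidefinite program $$\max_{V}\ \operatorname{Tr}\left(\begin{bmatrix} C & D\end{bmatrix} V \begin{bmatrix} C & D\end{bmatrix}^*\right)$$ over Hermitian $V\in\mathbb{C}^{(n+m)\times(n+m)}$ subject to $V\succeq 0$ and $$\begin{bmatrix} I_n & 0_{n,m}\end{bmatrix} V \begin{bmatrix} I_n \\ 0_{m,n}\end{bmatrix} = \begin{bmatrix} A & B\end{bmatrix} V \begin{bmatrix} A^* \\ B^*\end{bmatrix},\qquad \operatorname{Tr}\left(\begin{bmatrix} 0_{m,n} & I_m\end{bmatrix} V \begin{bmatrix} 0_{m,n} & I_m\end{bmatrix}^*\right)\le 1,$$ $$2\cos\theta_0\begin{bmatrix} I_n & 0_{n,m}\end{bmatrix} V \begin{bmatrix} I_n \\ 0_{m,n}\end{bmatrix}\preceq \begin{bmatrix} A & B\end{bmatrix} V \begin{bmatrix} I_n \\ 0_{m,n}\end{bmatrix}+\begin{bmatrix} I_n & 0_{n,m}\end{bmatrix} V \begin{bmatrix} A^* \\ B^*\end{bmatrix}.$$ Its optimal value equals the optimal value of the problem $$\max_{\mathbf{w},\mathbf{x}}\ \lim_{N\to\infty}\frac1N\sum_{k=0}^{N-1} z_k^* z_k$$ over sequences $\mathbf{w}=(w_k)_{k\ge 0}$ in $\mathbb{C}^m$ and $\mathbf{x}=(x_k)_{k\ge0}$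 in $\mathbb{C}^n$ subject to $x_0=0$, $x_{k+1}=Ax_k+Bw_k$ and $z_k=Cx_k+Dw_k$ for all $k\ge 0$, $\|\mathbf{w}\|_p\le 1$, and $\mathbf{w}\in\mathcal{W}_L$, where $\mathcal{W}_L$ is the set of sequences of the form $w_k=e^{j\theta k}w_s$ $(k\ge0)$ with $\theta\in[-\theta_0,\theta_0]$ and $w_s\in\mathbb{C}^m$.
   Context: $j$ is the imaginary unit; $W^*$ is the conjugate transpose of $W$; $X\succeq 0$ means $X$ is (Hermitian) positive semidefinite and $X\preceq Y$ means $Y-X\succeq0$; $I_n$ is the $n\times n$ identity and $0_{m,n}$ the $m\times n$ zero matrix; $n,m,l\ge1$. A square matrix is Schur stable if its spectral radius is less than $1$. The power norm of a sequence $\mathbf{h}=(h_k)_{k\ge0}$ of complex vectors is given by $\|\mathbf{h}\|_p^2=\lim_{N\to\infty}\frac1N\sum_{k=0}^{N-1}h_k^*h_k$. *)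

theory Defs
  imports Complex_Main "Jordan_Normal_Form.Spectral_Radius"
begin

definition schur_stable :: "complex mat \<Rightarrow> bool" where
  "schur_stable A \<longleftrightarrow> spectral_radius A < 1"

definition mat_trace :: "complex mat \<Rightarrow> complex" where
  "mat_trace X = (\<Sum>i<dim_row X. X $$ (i, i))"

definition hermitian :: "complex mat \<Rightarrow> bool" where
  "hermitian X \<longleftrightarrow> square_mat X \<and> mat_adjoint X = X"

text \<open>The number \<open>(X *\<^sub>v v) \<bullet>c v\<close> is \<open>v\<^sup>* X v\<close>; it is real for Hermitian \<open>X\<close>.\<close>

definition psd :: "complex mat \<Rightarrow> bool" where
  "psd X \<longleftrightarrow> hermitian X \<and>
     (\<forall>v \<in> carrier_vec (dim_row X). 0 \<le> Re ((X *\<^sub>v v) \<bullet>c v))"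

definition loewner_le :: "complex mat \<Rightarrow> complex mat \<Rightarrow> bool" where
  "loewner_le X Y \<longleftrightarrow> psd (Y - X)"

text \<open>The horizontal analogue \<open>[X Y]\<close> of \<^const>\<open>append_rows\<close>, for \<open>X\<close> and \<open>Y\<close> with equally
  many rows.\<close>

definition append_cols :: "complex mat \<Rightarrow> complex mat \<Rightarrow> complex mat" where
  "append_cols X Y = four_block_mat X Y (0\<^sub>m 0 (dim_col X)) (0\<^sub>m 0 (dim_col Y))"

text \<open>The traces in the next two definitions are real because \<open>V\<close> is Hermitian, so \<^const>\<open>Re\<close> only
  changes the type.\<close>

definition sdp_objective :: "complex mat \<Rightarrow> complex mat \<Rightarrow> complex mat \<Rightarrow> real" where
  "sdp_objective C D V =
     Re (mat_trace (append_cols C D * V * mat_adjoint (append_cols C D)))"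

definition sdp_feasible ::
  "nat \<Rightarrow> nat \<Rightarrow> complex mat \<Rightarrow> complex mat \<Rightarrow> real \<Rightarrow> complex mat \<Rightarrow> bool" where
  "sdp_feasible n m A B \<theta>0 V \<longleftrightarrow>
     (let AB = append_cols A B;
          AB' = mat_adjoint A @\<^sub>r mat_adjoint B;
          I0 = append_cols (1\<^sub>m n) (0\<^sub>m n m);
          I0' = 1\<^sub>m n @\<^sub>r 0\<^sub>m m n;
          OI = append_cols (0\<^sub>m m n) (1\<^sub>m m)
      in V \<in> carrier_mat (n + m) (n + m) \<and> hermitian V \<and> psd V \<and>
         I0 * V * I0' = AB * V * AB' \<and>
         Re (mat_trace (OI * V * mat_adjoint OI)) \<le> 1 \<and>
         loewner_le (complex_of_real (2 * cos \<theta>0) \<cdot>\<^sub>m (I0 * V * I0'))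
                    (AB * V * I0' + I0 * V * AB'))"

definition mean_power :: "(nat \<Rightarrow> complex vec) \<Rightarrow> nat \<Rightarrow> real" where
  "mean_power h N = (1 / real N) * (\<Sum>k<N. Re (h k \<bullet>c h k))"

definition power_norm :: "(nat \<Rightarrow> complex vec) \<Rightarrow> real" where
  "power_norm h = sqrt (lim (mean_power h))"

definition W_L :: "nat \<Rightarrow> real \<Rightarrow> (nat \<Rightarrow> complex vec) set" where
  "W_L m \<theta>0 = {w. \<exists>\<theta> \<in> {-\<theta>0..\<theta>0}. \<exists>ws \<in> carrier_vec m.
      \<forall>k. w k = exp (\<i> * complex_of_real \<theta> * of_nat k) \<cdot>\<^sub>v ws}"

definition sys_output ::
  "complex mat \<Rightarrow> complex mat \<Rightarrow> (nat \<Rightarrow> complex vec) \<Rightarrow> (nat \<Rightarrow> complex vec) \<Rightarrow> nat \<Rightarrow> complex vec" where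
  "sys_output C D w x k = C *\<^sub>v x k + D *\<^sub>v w k"

definition traj_feasible ::
  "nat \<Rightarrow> nat \<Rightarrow> complex mat \<Rightarrow> complex mat \<Rightarrow> real \<Rightarrow>
    (nat \<Rightarrow> complex vec) \<times> (nat \<Rightarrow> complex vec) \<Rightarrow> bool" where
  "traj_feasible n m A B \<theta>0 = (\<lambda>(w, x).
     (\<forall>k. w k \<in> carrier_vec m) \<and> (\<forall>k. x k \<in> carrier_vec n) \<and>
     x 0 = 0\<^sub>v n \<and> (\<forall>k. x (Suc k) = A *\<^sub>v x k + B *\<^sub>v w k) \<and>
     power_norm w \<le> 1 \<and> w \<in> W_L m \<theta>0)"

definition traj_objective ::
  "complex mat \<Rightarrow> complex mat \<Rightarrow> (nat \<Rightarrow> complex vec) \<times> (nat \<Rightarrow> complex vec) \<Rightarrow> real" where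
  "traj_objective C D = (\<lambda>(w, x). lim (mean_power (sys_output C D w x)))"

end

theory Submission
  imports Defs
begin

text \<open>Both optimal values equal the square of the largest gain of the transfer function
\<open>K \<theta> = C (e\<^sup>j\<^sup>\<theta> I - A)\<^sup>-\<^sup>1 B + D\<close> over the frequencies \<open>\<bar>\<theta>\<bar> \<le> \<theta>0\<close>.

For the sequences this is the steady-state response: an input \<open>e\<^sup>j\<^sup>\<theta>\<^sup>k w\<^sub>s\<close> drives the state along
\<open>e\<^sup>j\<^sup>\<theta>\<^sup>k x\<^sub>s - A\<^sup>k x\<^sub>s\<close> with \<open>x\<^sub>s = (e\<^sup>j\<^sup>\<theta> I - A)\<^sup>-\<^sup>1 B w\<^sub>s\<close>, and the transient decays geometrically, so the
power of the output exists and is \<open>|K \<theta> w\<^sub>s|\<^sup>2\<close> (lemma \<open>mean_power_output\<close>). The largest squared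
gain at a frequency is the top eigenvalue of \<open>(K \<theta>)\<^sup>* K \<theta>\<close>; it is attained by a unit vector and
continuous in \<open>\<theta>\<close> (\<open>continuous_max_gain\<close>), hence has a maximum on the compact interval.

The rank-one matrix \<open>V = v v\<^sup>*\<close> with \<open>v = (x\<^sub>s, w\<^sub>s)\<close> is feasible for the semidefinite program and has
the same objective (\<open>sdp_feasible_rank_one\<close>). The work lies in the converse: no feasible \<open>V\<close>
does better. If \<open>V\<close> is a sum of matrices \<open>v v\<^sup>*\<close> in which each \<open>v = (x, w)\<close> satisfies
\<open>A x + B w = e\<^sup>j\<^sup>\<phi> x\<close> for some admissible frequency \<open>\<phi>\<close>, then the objective is the sum of the
\<open>|C x + D w|\<^sup>2 = |K \<phi> w|\<^sup>2\<close> while the trace constraint says that the \<open>|w|\<^sup>2\<close> sum to at most one, and the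
bound follows. Such a decomposition is the content of \<open>psd_rank_one_decomposition\<close>. Writing \<open>V = M M\<^sup>*\<close>,
\<open>F = [A B] M\<close> and \<open>G = [I 0] M\<close>, the constraints read \<open>F F\<^sup>* = G G\<^sup>*\<close> and
\<open>F G\<^sup>* + G F\<^sup>* \<succeq> 2 cos \<theta>0 G G\<^sup>*\<close>, and one needs an orthonormal basis of vectors \<open>u\<close> with
\<open>F u = e\<^sup>j\<^sup>\<phi> G u\<close>. A Moebius map sends the arc \<open>\<bar>\<phi>\<bar> \<le> \<theta>\<close> of the unit circle to the half-line
\<open>[0, \<infinity>]\<close> and turns the question into one about a positive semidefinite matrix, which the spectral theorem
diagonalizes (\<open>unitary_pencil\<close>). This works for every arc strictly larger than the given one;
continuity of the largest gain then closes the gap.\<close>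

section \<open>Products, adjoints and squared norms\<close>

text \<open>The algebraic laws below have dimensions instead of carriers in their hypotheses, so that
rewriting can discharge the hypotheses once the dimensions of the factors are known; a carrier
hypothesis hides the inner dimension, which rewriting would have to guess.\<close>

lemma mult_mat_assoc: "dim_col A = dim_row B \<Longrightarrow> dim_col B = dim_row C \<Longrightarrow> (A * B) * C = A * (B * C)"
  for A :: "complex mat"
  by (rule assoc_mult_mat) auto

lemma mult_mat_vec_assoc: "dim_col A = dim_row B \<Longrightarrow> dim_col B = dim_vec v \<Longrightarrow> (A * B) *\<^sub>v v = A *\<^sub>v (B *\<^sub>v v)"
  for A :: "complex mat"
  by (rule assoc_mult_mat_vec) (auto intro: carrier_vecI)

lemma dim_mat_diag [simp]: "dim_row (mat_diag n f) = n" "dim_col (mat_diag n f) = n"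
  by (simp_all add: mat_diag_def)

lemma mult_mat_vec_smult: "dim_col A = dim_vec v \<Longrightarrow> A *\<^sub>v (k \<cdot>\<^sub>v v) = k \<cdot>\<^sub>v (A *\<^sub>v v)"
  for A :: "complex mat"
  by (rule mult_mat_vec) (auto intro: carrier_vecI)

lemma mult_mat_vec_minus: "dim_col A = dim_vec v \<Longrightarrow> dim_vec w = dim_vec v \<Longrightarrow>
    A *\<^sub>v (v - w) = A *\<^sub>v v - A *\<^sub>v w"
  for A :: "complex mat"
  by (rule mult_minus_distrib_mat_vec) (auto intro: carrier_vecI)

lemma smult_mat_mult_vec: "dim_col A = dim_vec v \<Longrightarrow> (c \<cdot>\<^sub>m A) *\<^sub>v v = c \<cdot>\<^sub>v (A *\<^sub>v v)"
  for A :: "complex mat"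
  by (intro eq_vecI) (auto simp: scalar_prod_def sum_distrib_left mult.assoc)

lemma vec_eq_if_minus_eq_0:
  fixes x y :: "complex vec"
  assumes "x - y = 0\<^sub>v N" "dim_vec x = N" "dim_vec y = N"
  shows "x = y"
proof (rule eq_vecI)
  fix i assume "i < dim_vec y"
  thus "x $ i = y $ i" using arg_cong[OF assms(1), of "\<lambda>v. v $ i"] assms(2,3) by simp
qed (use assms in simp)

lemma mat_eqI_vec:
  fixes A B :: "complex mat"
  assumes "A \<in> carrier_mat n m" "B \<in> carrier_mat n m"
    and "\<And>v. v \<in> carrier_vec m \<Longrightarrow> A *\<^sub>v v = B *\<^sub>v v"
  shows "A = B"
proof (rule eq_matI)
  fix i j assume "i < dim_row B" "j < dim_col B"
  hence ij: "i < n" "j < m" using assms by auto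
  have "(A *\<^sub>v unit_vec m j) $ i = (B *\<^sub>v unit_vec m j) $ i" using assms(3) by simp
  thus "A $$ (i, j) = B $$ (i, j)" using ij assms(1,2) by simp
qed (use assms in auto)

lemma dim_mat_adjoint [simp]:
  "dim_row (mat_adjoint A) = dim_col A" "dim_col (mat_adjoint A) = dim_row A"
  by (auto simp: mat_adjoint_def mat_of_rows_def)

lemma mat_adjoint_carrier [simp, intro]:
  "A \<in> carrier_mat n m \<Longrightarrow> mat_adjoint A \<in> carrier_mat m n"
  by (intro carrier_matI) simp_all

lemma index_mat_adjoint [simp]:
  fixes A :: "complex mat"
  shows "i < dim_col A \<Longrightarrow> j < dim_row A \<Longrightarrow> mat_adjoint A $$ (i, j) = cnj (A $$ (j, i))"
  by (simp add: mat_adjoint_def mat_of_rows_def)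

lemma mat_adjoint_adjoint [simp]:
  fixes A :: "complex mat" shows "mat_adjoint (mat_adjoint A) = A"
  by (rule eq_matI) auto

lemma mat_adjoint_mult:
  fixes A B :: "complex mat"
  assumes "dim_col A = dim_row B"
  shows "mat_adjoint (A * B) = mat_adjoint B * mat_adjoint A"
  using assms by (intro eq_matI) (auto simp: scalar_prod_def ac_simps)

lemma mat_adjoint_add:
  fixes A B :: "complex mat"
  assumes "A \<in> carrier_mat n m" "B \<in> carrier_mat n m"
  shows "mat_adjoint (A + B) = mat_adjoint A + mat_adjoint B"
  using assms by (intro eq_matI) auto

lemma mat_adjoint_smult:
  fixes A :: "complex mat"
  shows "mat_adjoint (c \<cdot>\<^sub>m A) = cnj c \<cdot>\<^sub>m mat_adjoint A"
  by (intro eq_matI) auto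

lemma mat_adjoint_one [simp]: "mat_adjoint (1\<^sub>m n :: complex mat) = 1\<^sub>m n"
  by (intro eq_matI) auto

lemma mat_adjoint_zero [simp]: "mat_adjoint (0\<^sub>m n m :: complex mat) = 0\<^sub>m m n"
  by (intro eq_matI) auto

lemma mat_adjoint_four_block:
  fixes A B C D :: "complex mat"
  assumes "A \<in> carrier_mat n1 m1" "B \<in> carrier_mat n1 m2"
    "C \<in> carrier_mat n2 m1" "D \<in> carrier_mat n2 m2"
  shows "mat_adjoint (four_block_mat A B C D) =
    four_block_mat (mat_adjoint A) (mat_adjoint C) (mat_adjoint B) (mat_adjoint D)"
  using assms by (intro eq_matI) auto

lemma cscalar_prod_mat_adjoint:
  fixes A :: "complex mat"
  assumes "A \<in> carrier_mat n m" "x \<in> carrier_vec m" "y \<in> carrier_vec n"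
  shows "(A *\<^sub>v x) \<bullet>c y = x \<bullet>c (mat_adjoint A *\<^sub>v y)"
proof -
  have "(A *\<^sub>v x) \<bullet>c y = (\<Sum>i<n. \<Sum>j<m. A $$ (i, j) * x $ j * cnj (y $ i))"
    using assms by (simp add: scalar_prod_def sum_distrib_right atLeast0LessThan)
  also have "\<dots> = (\<Sum>j<m. \<Sum>i<n. A $$ (i, j) * x $ j * cnj (y $ i))"
    by (rule sum.swap)
  also have "\<dots> = x \<bullet>c (mat_adjoint A *\<^sub>v y)"
    using assms
    by (simp add: scalar_prod_def sum_distrib_left atLeast0LessThan cnj_sum ac_simps)
  finally show ?thesis .
qed

definition norm_sq :: "complex vec \<Rightarrow> real" where
  "norm_sq v = (\<Sum>i<dim_vec v. (cmod (v $ i))\<^sup>2)"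

lemma cscalar_prod_self: "v \<bullet>c v = complex_of_real (norm_sq v)"
proof -
  have "complex_of_real (norm_sq v) = (\<Sum>i<dim_vec v. v $ i * cnj (v $ i))"
    unfolding norm_sq_def of_real_sum complex_norm_square ..
  thus ?thesis by (simp add: scalar_prod_def atLeast0LessThan)
qed

lemma norm_sq_nonneg [simp]: "0 \<le> norm_sq v"
  by (simp add: norm_sq_def sum_nonneg)

lemma norm_sq_eq_0:
  assumes "v \<in> carrier_vec n" shows "norm_sq v = 0 \<longleftrightarrow> v = 0\<^sub>v n"
  using conjugate_square_eq_0_vec[OF assms] by (simp add: cscalar_prod_self)

lemma norm_sq_smult: "norm_sq (c \<cdot>\<^sub>v v) = (cmod c)\<^sup>2 * norm_sq v"
  by (simp add: norm_sq_def norm_mult power_mult_distrib sum_distrib_left)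

lemma norm_sq_mult_mat_vec:
  assumes "A \<in> carrier_mat n m" "x \<in> carrier_vec m"
  shows "complex_of_real (norm_sq (A *\<^sub>v x)) = ((mat_adjoint A * A) *\<^sub>v x) \<bullet>c x"
proof -
  have "((mat_adjoint A * A) *\<^sub>v x) \<bullet>c x = (mat_adjoint A *\<^sub>v (A *\<^sub>v x)) \<bullet>c x"
    using assms by (subst assoc_mult_mat_vec[of _ m n _ m]) auto
  also have "\<dots> = (A *\<^sub>v x) \<bullet>c (A *\<^sub>v x)"
    using assms cscalar_prod_mat_adjoint[of "mat_adjoint A" m n "A *\<^sub>v x" x] by auto
  finally show ?thesis by (simp add: cscalar_prod_self)
qed

lemma quadratic_form_gram:
  assumes "M \<in> carrier_mat n k" "v \<in> carrier_vec n"
  shows "((M * mat_adjoint M) *\<^sub>v v) \<bullet>c v = complex_of_real (norm_sq (mat_adjoint M *\<^sub>v v))"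
  using norm_sq_mult_mat_vec[of "mat_adjoint M" k n v] assms by auto

lemma mat_adjoint_diag [simp]:
  "mat_adjoint (mat_diag n (\<lambda>i. complex_of_real (d i))) = mat_diag n (\<lambda>i. complex_of_real (d i))"
  by (intro eq_matI) (auto simp: mat_diag_def)

section \<open>The spectral theorem for Hermitian matrices\<close>

definition unitary_mat :: "nat \<Rightarrow> complex mat \<Rightarrow> bool" where
  "unitary_mat n U \<longleftrightarrow> U \<in> carrier_mat n n \<and> mat_adjoint U * U = 1\<^sub>m n \<and> U * mat_adjoint U = 1\<^sub>m n"

lemma unitary_mat_mult:
  assumes "unitary_mat n U" "unitary_mat n W"
  shows "unitary_mat n (U * W)"
proof -
  note U = assms(1)[unfolded unitary_mat_def] and W = assms(2)[unfolded unitary_mat_def]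
  have c: "U \<in> carrier_mat n n" "W \<in> carrier_mat n n" "mat_adjoint U \<in> carrier_mat n n"
    "mat_adjoint W \<in> carrier_mat n n" using U W by auto
  have d [simp]: "dim_row U = n" "dim_col U = n" "dim_row W = n" "dim_col W = n" using c by auto
  have "mat_adjoint (U * W) * (U * W) = mat_adjoint W * (mat_adjoint U * U) * W"
    using c by (simp add: mat_adjoint_mult mult_mat_assoc)
  also have "\<dots> = 1\<^sub>m n" using U W c by simp
  finally have 1: "mat_adjoint (U * W) * (U * W) = 1\<^sub>m n" .
  have "(U * W) * mat_adjoint (U * W) = U * (W * mat_adjoint W) * mat_adjoint U"
    using c by (simp add: mat_adjoint_mult mult_mat_assoc)
  also have "\<dots> = 1\<^sub>m n" using U W c by simp
  finally have 2: "(U * W) * mat_adjoint (U * W) = 1\<^sub>m n" .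
  show ?thesis using 1 2 c by (simp add: unitary_mat_def)
qed

lemma unitary_first_column:
  fixes v :: "complex vec"
  assumes v: "v \<in> carrier_vec n" and v0: "v \<noteq> 0\<^sub>v n"
  obtains W c where "W \<in> carrier_mat n n" "mat_adjoint W * W = 1\<^sub>m n" "W * mat_adjoint W = 1\<^sub>m n"
    "col W 0 = c \<cdot>\<^sub>v v"
proof -
  have n: "0 < n" using v v0 by (cases n) auto
  interpret cof_vec_space n "TYPE(complex)" .
  define b where "b = basis_completion v"
  define ws where "ws = gram_schmidt n b"
  from basis_completion[OF v v0, folded b_def]
  have dist_b: "distinct b" and indep: "\<not> lin_dep (set b)" and b: "set b \<subseteq> carrier_vec n"
    and hdb: "hd b = v" and len_b: "length b = n" by auto
  from hdb len_b n obtain vs where bv: "b = v # vs" by (cases b) auto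
  from gram_schmidt_result[OF b dist_b indep refl, folded ws_def]
  have ws: "set ws \<subseteq> carrier_vec n" "corthogonal ws" "length ws = n"
    by (auto simp: len_b)
  from gram_schmidt_hd[OF v, of vs, folded bv] have hdws: "hd ws = v" unfolding ws_def .
  have ws0: "ws ! 0 = v" using hdws ws(3) n by (cases ws) auto
  have wsc: "ws ! i \<in> carrier_vec n" if "i < n" for i using that ws by auto
  have orth: "ws ! i \<bullet>c ws ! j = 0 \<longleftrightarrow> i \<noteq> j" if "i < n" "j < n" for i j
    using corthogonalD[OF ws(2)] that ws(3) by auto
  define s where "s i = sqrt (norm_sq (ws ! i))" for i
  have s0: "s i \<noteq> 0" if "i < n" for i
    using orth[OF that that] by (auto simp: s_def cscalar_prod_self)
  \<comment> \<open>Gram-Schmidt keeps the direction of the first vector and yields an orthogonal basis,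
    which remains to be normalized.\<close>
  define W where "W = mat n n (\<lambda>(i, j). (ws ! j $ i) / complex_of_real (s j))"
  have W: "W \<in> carrier_mat n n" by (simp add: W_def)
  have 1: "mat_adjoint W * W = 1\<^sub>m n"
  proof (rule eq_matI)
    fix i j assume "i < dim_row (1\<^sub>m n :: complex mat)" "j < dim_col (1\<^sub>m n :: complex mat)"
    hence ij: "i < n" "j < n" by auto
    have "(mat_adjoint W * W) $$ (i, j) = (\<Sum>k<n. cnj (W $$ (k, i)) * W $$ (k, j))"
      using ij W by (simp add: scalar_prod_def atLeast0LessThan)
    also have "\<dots> = (\<Sum>k<n. ws ! j $ k * cnj (ws ! i $ k)) / (of_real (s i) * of_real (s j))"
      using ij by (simp add: W_def sum_divide_distrib ac_simps)
    also have "(\<Sum>k<n. ws ! j $ k * cnj (ws ! i $ k)) = ws ! j \<bullet>c ws ! i"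
      using wsc[OF ij(1)] wsc[OF ij(2)] by (simp add: scalar_prod_def atLeast0LessThan)
    also have "\<dots> / (of_real (s i) * of_real (s j)) = (if i = j then 1 else 0)"
    proof (cases "i = j")
      case True
      have "s j * s j = norm_sq (ws ! j)" by (simp add: s_def)
      hence "ws ! j \<bullet>c ws ! j = of_real (s j) * of_real (s j)"
        by (metis cscalar_prod_self of_real_mult)
      thus ?thesis using True s0[OF ij(2)] by simp
    next
      case False thus ?thesis using orth[OF ij(2) ij(1)] by simp
    qed
    finally show "(mat_adjoint W * W) $$ (i, j) = 1\<^sub>m n $$ (i, j)" using ij by simp
  qed (use W in auto)
  have 2: "W * mat_adjoint W = 1\<^sub>m n"
    by (rule mat_mult_left_right_inverse[OF _ W 1]) (use W in auto)
  have 3: "col W 0 = (1 / complex_of_real (s 0)) \<cdot>\<^sub>v v"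
    using n v ws0 by (intro eq_vecI) (auto simp: W_def)
  from that[OF W 1 2 3] show ?thesis .
qed

text \<open>In an orthonormal basis that starts with an eigenvector, the first column of the matrix is a
multiple of the first unit vector. Hermitian symmetry transfers this to the first row and makes the
eigenvalue real, and the remaining block is again Hermitian.\<close>

lemma hermitian_deflation:
  fixes A :: "complex mat"
  assumes A: "A \<in> carrier_mat (Suc n) (Suc n)" and herm: "mat_adjoint A = A"
  obtains W e A' where "unitary_mat (Suc n) W" "A' \<in> carrier_mat n n" "mat_adjoint A' = A'"
    "A = W * four_block_mat (mat 1 1 (\<lambda>_. complex_of_real e)) (0\<^sub>m 1 n) (0\<^sub>m n 1) A' * mat_adjoint W"
proof -
  let ?N = "Suc n"
  obtain e v where v: "v \<in> carrier_vec ?N" "v \<noteq> 0\<^sub>v ?N" and ev: "A *\<^sub>v v = e \<cdot>\<^sub>v v"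
    using spectrum_non_empty[OF A] A by (auto simp: spectrum_def eigenvalue_def eigenvector_def)
  obtain W c where W: "W \<in> carrier_mat ?N ?N" and W1: "mat_adjoint W * W = 1\<^sub>m ?N"
    and W2: "W * mat_adjoint W = 1\<^sub>m ?N" and W0: "col W 0 = c \<cdot>\<^sub>v v"
    using unitary_first_column[OF v] .
  note Wa = mat_adjoint_carrier[OF W]
  have d [simp]: "dim_row W = ?N" "dim_col W = ?N" "dim_row A = ?N" "dim_col A = ?N" using W A by auto
  define A1 where "A1 = mat_adjoint W * (A * W)"
  have A1: "A1 \<in> carrier_mat ?N ?N" by (intro carrier_matI) (simp_all add: A1_def)
  have AA1: "A = W * A1 * mat_adjoint W"
  proof -
    have "W * A1 * mat_adjoint W = (W * mat_adjoint W) * A * (W * mat_adjoint W)"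
      using W Wa A by (simp add: A1_def mult_mat_assoc)
    thus ?thesis using A by (simp add: W2)
  qed
  have h1: "mat_adjoint A1 = A1"
by (simp add: A1_def mat_adjoint_mult herm mult_mat_assoc)
  have h1': "A1 $$ (j, i) = cnj (A1 $$ (i, j))" if "i < ?N" "j < ?N" for i j
    using index_mat_adjoint[of j A1 i] A1 that by (simp add: h1)
  have "col A1 0 = mat_adjoint W *\<^sub>v (A *\<^sub>v col W 0)"
    using W Wa A unfolding A1_def by (simp add: col_mult2[of _ ?N ?N _ ?N] del: col_mult)
  also have "A *\<^sub>v col W 0 = e \<cdot>\<^sub>v col W 0"
    unfolding W0 using v A ev by (simp add: mult_mat_vec_smult smult_smult_assoc mult.commute)
  also have "mat_adjoint W *\<^sub>v (e \<cdot>\<^sub>v col W 0) = e \<cdot>\<^sub>v col (mat_adjoint W * W) 0"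
    using W Wa by (simp add: mult_mat_vec_smult col_mult2[of _ ?N ?N _ ?N])
  finally have col0: "col A1 0 = e \<cdot>\<^sub>v unit_vec ?N 0" by (simp add: W1)
  have z: "A1 $$ (i, 0) = (if i = 0 then e else 0)" if "i < ?N" for i
    using arg_cong[OF col0, of "\<lambda>v. v $ i"] A1 that by auto
  have ce: "cnj e = e" using h1'[of 0 0] unfolding z[of 0, simplified] by simp
  hence e: "complex_of_real (Re e) = e" by (metis Reals_cnj_iff of_real_Re)
  define A' where "A' = mat n n (\<lambda>(i, j). A1 $$ (Suc i, Suc j))"
  have A': "A' \<in> carrier_mat n n" by (simp add: A'_def)
  have hA': "mat_adjoint A' = A'"
    by (intro eq_matI) (auto simp: A'_def h1'[symmetric])
  have "A1 = four_block_mat (mat 1 1 (\<lambda>_. complex_of_real (Re e))) (0\<^sub>m 1 n) (0\<^sub>m n 1) A'"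
    using A1 h1'[of _ 0] by (intro eq_matI) (auto simp: A'_def e z ce)
  with AA1 that[of W A' "Re e"] W W1 W2 A' hA' show ?thesis by (simp add: unitary_mat_def)
qed

theorem hermitian_spectral_theorem:
  fixes A :: "complex mat"
  assumes "A \<in> carrier_mat n n" "mat_adjoint A = A"
  shows "\<exists>U d. unitary_mat n U \<and> A = U * mat_diag n (\<lambda>i. complex_of_real (d i)) * mat_adjoint U"
  using assms
proof (induction n arbitrary: A)
  case 0
  thus ?case
    by (intro exI[of _ "1\<^sub>m 0"] exI[of _ "\<lambda>_. 0"]) (auto simp: unitary_mat_def)
next
  case (Suc n)
  let ?N = "Suc n"
  obtain W e A' where W: "unitary_mat ?N W" and A': "A' \<in> carrier_mat n n" "mat_adjoint A' = A'"
    and A: "A = W * four_block_mat (mat 1 1 (\<lambda>_. complex_of_real e)) (0\<^sub>m 1 n) (0\<^sub>m n 1) A' * mat_adjoint W"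
    using hermitian_deflation[OF Suc.prems] .
  obtain U d where U: "unitary_mat n U"
    and A'U: "A' = U * mat_diag n (\<lambda>i. complex_of_real (d i)) * mat_adjoint U"
    using Suc.IH[OF A'] by auto
  have Uc: "U \<in> carrier_mat n n" "mat_adjoint U \<in> carrier_mat n n" 
    "mat_adjoint U * U = 1\<^sub>m n" "U * mat_adjoint U = 1\<^sub>m n" using U by (auto simp: unitary_mat_def)
  have Wc: "W \<in> carrier_mat ?N ?N" "mat_adjoint W \<in> carrier_mat ?N ?N" 
    using W by (auto simp: unitary_mat_def)
  define P where "P = four_block_mat (1\<^sub>m 1) (0\<^sub>m 1 n) (0\<^sub>m n 1) U"
  have Pa: "mat_adjoint P = four_block_mat (1\<^sub>m 1) (0\<^sub>m 1 n) (0\<^sub>m n 1) (mat_adjoint U)"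
    unfolding P_def using Uc by (subst mat_adjoint_four_block[of _ 1 1 _ n _ n]) auto
  have Pc: "P \<in> carrier_mat ?N ?N" "mat_adjoint P \<in> carrier_mat ?N ?N"
    using four_block_carrier_mat[of "1\<^sub>m 1" 1 1 U n n] Uc by (auto simp: P_def)
  define D where "D = mat_diag ?N (\<lambda>i. complex_of_real (case i of 0 \<Rightarrow> e | Suc i \<Rightarrow> d i))"
  have Dc: "D \<in> carrier_mat ?N ?N" by (simp add: D_def)
  have D: "D = four_block_mat (mat 1 1 (\<lambda>_. complex_of_real e)) (0\<^sub>m 1 n) (0\<^sub>m n 1)
     (mat_diag n (\<lambda>i. complex_of_real (d i)))"
    by (intro eq_matI) (auto simp: D_def mat_diag_def split: nat.splits)
  have Pu: "unitary_mat ?N P"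
  proof -
    have "mat_adjoint P * P = 1\<^sub>m (1 + n)" unfolding Pa unfolding P_def
      using Uc by (subst mult_four_block_mat[of _ 1 1 _ n _ n _ _ 1 _ n])
        (auto simp: four_block_one_mat[of 1 n, simplified])
    moreover have "P * mat_adjoint P = 1\<^sub>m (1 + n)" unfolding Pa unfolding P_def
      using Uc by (subst mult_four_block_mat[of _ 1 1 _ n _ n _ _ 1 _ n])
        (auto simp: four_block_one_mat[of 1 n, simplified])
    ultimately show ?thesis using Pc by (simp add: unitary_mat_def)
  qed
  have "P * D * mat_adjoint P = 
      four_block_mat (mat 1 1 (\<lambda>_. complex_of_real e)) (0\<^sub>m 1 n) (0\<^sub>m n 1) A'"
    unfolding Pa unfolding P_def D using Uc
    by (subst mult_four_block_mat[of _ 1 1 _ n _ n _ _ 1 _ n]; (subst mult_four_block_mat[of _ 1 1 _ n _ n _ _ 1 _ n])?)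
       (auto simp: A'U intro!: cong_four_block_mat)
  hence "A = W * (P * D * mat_adjoint P) * mat_adjoint W" using A by simp
  also have "\<dots> = (W * P) * D * mat_adjoint (W * P)"
    using carrier_matD[OF Wc(1)] carrier_matD[OF Pc(1)] carrier_matD[OF Dc] by (simp add: mat_adjoint_mult mult_mat_assoc)
  finally show ?case using unitary_mat_mult[OF W Pu] D_def by blast
qed

lemma unitary_mat_dim:
  assumes "unitary_mat n U"
  shows "dim_row U = n" "dim_col U = n" 
  using assms by (auto simp: unitary_mat_def)

lemma norm_sq_col_unitary:
  assumes "unitary_mat n U" "i < n"
  shows "norm_sq (col U i) = 1"
proof -
  note [simp] = unitary_mat_dim[OF assms(1)]
  have "complex_of_real (norm_sq (col U i)) = (mat_adjoint U * U) $$ (i, i)"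
    using assms(2) by (simp add: cscalar_prod_self[symmetric] scalar_prod_def mult.commute)
  also have "\<dots> = 1" using assms by (simp add: unitary_mat_def)
  finally show ?thesis by simp
qed

lemma diagonalized_eigenvector:
  assumes "unitary_mat n U" "i < n"
  shows "(U * mat_diag n f * mat_adjoint U) *\<^sub>v col U i = f i \<cdot>\<^sub>v col U i"
proof -
  note [simp] = unitary_mat_dim[OF assms(1)]
  have U: "U \<in> carrier_mat n n" using assms by (simp add: unitary_mat_def)
  have "mat_adjoint U *\<^sub>v col U i = col (mat_adjoint U * U) i"
    using assms(2) U by (subst col_mult2[of _ n n _ n]) auto
  also have "\<dots> = unit_vec n i" using assms by (simp add: unitary_mat_def)
  finally have 1: "mat_adjoint U *\<^sub>v col U i = unit_vec n i" .
  have "mat_diag n f *\<^sub>v unit_vec n i = f i \<cdot>\<^sub>v unit_vec n i"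
    using assms(2) by (intro eq_vecI) (auto simp: mat_diag_def)
  moreover have "U *\<^sub>v unit_vec n i = col U i"
    using assms(2) U by (intro eq_vecI) auto
  ultimately show ?thesis by (simp add: mult_mat_vec_assoc 1 mult_mat_vec_smult)
qed

lemma norm_sq_unitary_adjoint:
  assumes "unitary_mat n U" "v \<in> carrier_vec n"
  shows "norm_sq (mat_adjoint U *\<^sub>v v) = norm_sq v"
proof -
  have U: "U \<in> carrier_mat n n" "U * mat_adjoint U = 1\<^sub>m n" using assms by (auto simp: unitary_mat_def)
  have "complex_of_real (norm_sq (mat_adjoint U *\<^sub>v v)) = complex_of_real (norm_sq v)"
    using quadratic_form_gram[OF U(1) assms(2)] U(2) assms(2) by (simp add: cscalar_prod_self)
  thus ?thesis by simp
qed

text \<open>In an eigenbasis the quadratic form is a sum of squares weighted by the eigenvalues, so it is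
largest, relative to the squared norm, at an eigenvector of the largest eigenvalue.\<close>

lemma hermitian_rayleigh:
  fixes H :: "complex mat"
  assumes H: "H \<in> carrier_mat n n" "mat_adjoint H = H" and n: "1 \<le> n"
  obtains \<mu> u where "u \<in> carrier_vec n" "norm_sq u = 1" "(H *\<^sub>v u) \<bullet>c u = complex_of_real \<mu>"
    "\<And>w. w \<in> carrier_vec n \<Longrightarrow> Re ((H *\<^sub>v w) \<bullet>c w) \<le> \<mu> * norm_sq w"
proof -
  obtain U d where U: "unitary_mat n U" 
    and HU: "H = U * mat_diag n (\<lambda>i. complex_of_real (d i)) * mat_adjoint U"
    using hermitian_spectral_theorem[OF H] by auto
  note [simp] = unitary_mat_dim[OF U]
  have Uc: "U \<in> carrier_mat n n" using U by (simp add: unitary_mat_def)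
  obtain p where p: "p < n" and max: "\<And>i. i < n \<Longrightarrow> d i \<le> d p"
  proof -
    have fin: "finite (d ` {..<n})" "d ` {..<n} \<noteq> {}" using n by (auto simp: lessThan_empty_iff)
    from Max_in[OF fin] obtain p where "p < n" "d p = Max (d ` {..<n})" by auto
    thus ?thesis using that[of p] fin by simp
  qed
  have c: "col U p \<in> carrier_vec n" by (intro carrier_vecI) simp
  have "H *\<^sub>v col U p = complex_of_real (d p) \<cdot>\<^sub>v col U p"
    unfolding HU by (rule diagonalized_eigenvector[OF U p])
  hence "(H *\<^sub>v col U p) \<bullet>c col U p = complex_of_real (d p)"
    using c by (simp add: cscalar_prod_self norm_sq_col_unitary[OF U p])
  moreover have "Re ((H *\<^sub>v w) \<bullet>c w) \<le> d p * norm_sq w" if w: "w \<in> carrier_vec n" for w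
  proof -
    define y where "y = mat_adjoint U *\<^sub>v w"
    let ?D = "mat_diag n (\<lambda>i. complex_of_real (d i))"
    have y: "y \<in> carrier_vec n" by (intro carrier_vecI) (simp add: y_def)
    have "H *\<^sub>v w = U *\<^sub>v (?D *\<^sub>v y)"
      using w by (simp add: HU y_def mult_mat_vec_assoc)
    hence "(H *\<^sub>v w) \<bullet>c w = (?D *\<^sub>v y) \<bullet>c y"
      using cscalar_prod_mat_adjoint[OF Uc _ w, of "?D *\<^sub>v y"] by (simp add: y_def carrier_vecI)
    also have "?D *\<^sub>v y = vec n (\<lambda>i. complex_of_real (d i) * y $ i)"
      using y by (intro eq_vecI) (auto simp: scalar_prod_def mat_diag_def if_distrib[of "\<lambda>x. x * _"] sum.delta' cong: if_cong)
    also have "\<dots> \<bullet>c y = (\<Sum>i<n. complex_of_real (d i) * (y $ i * cnj (y $ i)))"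
      using y by (simp add: scalar_prod_def atLeast0LessThan mult.assoc)
    also have "\<dots> = complex_of_real (\<Sum>i<n. d i * (cmod (y $ i))\<^sup>2)"
      by (simp only: complex_norm_square[symmetric] of_real_mult of_real_sum)
    finally have "Re ((H *\<^sub>v w) \<bullet>c w) = (\<Sum>i<n. d i * (cmod (y $ i))\<^sup>2)" by simp
    also have "\<dots> \<le> (\<Sum>i<n. d p * (cmod (y $ i))\<^sup>2)"
      by (intro sum_mono mult_right_mono) (auto simp: max)
    also have "\<dots> = d p * norm_sq y" using y by (simp add: norm_sq_def sum_distrib_left)
    also have "norm_sq y = norm_sq w" unfolding y_def by (rule norm_sq_unitary_adjoint[OF U w])
    finally show ?thesis .
  qed
  ultimately show ?thesis using that c norm_sq_col_unitary[OF U p] by blast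
qed

section \<open>Positive semidefinite matrices\<close>

lemma psdD:
  assumes "psd Z" "Z \<in> carrier_mat n n"
  shows "mat_adjoint Z = Z" "\<And>v. v \<in> carrier_vec n \<Longrightarrow> 0 \<le> Re ((Z *\<^sub>v v) \<bullet>c v)"
  using assms by (auto simp: psd_def hermitian_def)

lemma psdI:
  assumes "Z \<in> carrier_mat n n" "mat_adjoint Z = Z"
    "\<And>v. v \<in> carrier_vec n \<Longrightarrow> 0 \<le> Re ((Z *\<^sub>v v) \<bullet>c v)"
  shows "psd Z"
  using assms by (auto simp: psd_def hermitian_def)

lemma psd_gram:
  assumes "M \<in> carrier_mat n k"
  shows "psd (M * mat_adjoint M)"
  using assms quadratic_form_gram[OF assms] 
  by (intro psdI[of _ n]) (auto simp: mat_adjoint_mult intro!: carrier_matI)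

lemma psd_diagonalize:
  assumes "psd Z" "Z \<in> carrier_mat n n"
  obtains U d where "unitary_mat n U" "\<And>i. i < n \<Longrightarrow> 0 \<le> d i"
    "Z = U * mat_diag n (\<lambda>i. complex_of_real (d i)) * mat_adjoint U"
proof -
  obtain U d where U: "unitary_mat n U" 
    and Z: "Z = U * mat_diag n (\<lambda>i. complex_of_real (d i)) * mat_adjoint U"
    using hermitian_spectral_theorem[OF assms(2) psdD(1)[OF assms]] by auto
  have "0 \<le> d i" if i: "i < n" for i
  proof -
    have c: "col U i \<in> carrier_vec n" using U i by (auto simp: unitary_mat_def)
    have "(Z *\<^sub>v col U i) \<bullet>c col U i = complex_of_real (d i) * (col U i \<bullet>c col U i)"
      unfolding Z diagonalized_eigenvector[OF U i] using c by simp
    also have "\<dots> = complex_of_real (d i)"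
      by (simp add: cscalar_prod_self norm_sq_col_unitary[OF U i])
    finally show ?thesis using psdD(2)[OF assms c] by simp
  qed
  with U Z that show ?thesis by blast
qed

lemma psd_factorization:
  assumes "psd V" "V \<in> carrier_mat n n"
  obtains M where "M \<in> carrier_mat n n" "V = M * mat_adjoint M"
proof -
  obtain U d where U: "unitary_mat n U" and d: "\<And>i. i < n \<Longrightarrow> 0 \<le> d i"
    and V: "V = U * mat_diag n (\<lambda>i. complex_of_real (d i)) * mat_adjoint U"
    using psd_diagonalize[OF assms] by metis
  note [simp] = unitary_mat_dim[OF U]
  let ?S = "mat_diag n (\<lambda>i. complex_of_real (sqrt (d i)))"
  have "mat_diag n (\<lambda>i. complex_of_real (d i)) = ?S * ?S"
    using d by (simp, intro eq_matI) (auto simp: mat_diag_def of_real_mult[symmetric] simp del: of_real_mult)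
  hence "V = (U * ?S) * mat_adjoint (U * ?S)"
    by (simp add: V mult_mat_assoc mat_adjoint_mult del: mat_diag_diag)
  moreover have "U * ?S \<in> carrier_mat n n" by (intro carrier_matI) simp_all
  ultimately show ?thesis using that by blast
qed

text \<open>Inverting the nonzero eigenvalues gives the pseudo-inverse of \<open>Z\<close>, again positive
semidefinite; it is returned in the factored form \<open>R R\<^sup>*\<close>.\<close>

lemma psd_generalized_inverse:
  assumes "psd Z" "Z \<in> carrier_mat n n"
  obtains R where "R \<in> carrier_mat n n" "Z * (R * mat_adjoint R) * Z = Z"
proof -
  obtain U d where U: "unitary_mat n U" and d: "\<And>i. i < n \<Longrightarrow> 0 \<le> d i"
    and Z: "Z = U * mat_diag n (\<lambda>i. complex_of_real (d i)) * mat_adjoint U"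
    using psd_diagonalize[OF assms] by metis
  note [simp] = unitary_mat_dim[OF U]
  let ?D = "mat_diag n (\<lambda>i. complex_of_real (d i))"
  \<comment> \<open>For a vanishing eigenvalue, division by zero makes \<open>e i\<close> zero, as the pseudo-inverse requires.\<close>
  define e where "e i = 1 / sqrt (d i)" for i
  let ?S = "mat_diag n (\<lambda>i. complex_of_real (e i))"
  have UU: "mat_adjoint U * (U * X) = X" if "dim_row X = n" for X
    using that U by (simp add: mult_mat_assoc[symmetric] unitary_mat_def)
  have D: "?D * (?S * (?S * ?D)) = ?D"
  proof -
    have "complex_of_real (d i * (e i * (e i * d i))) = complex_of_real (d i)" if "i < n" for i
      using d[OF that] by (cases "d i = 0") (auto simp: e_def field_simps)
    thus ?thesis by (simp, intro eq_matI) (auto simp: mat_diag_def)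
  qed
  have D': "?D * (?S * (?S * (?D * X))) = ?D * X" if "dim_row X = n" for X
    using arg_cong[OF D, of "\<lambda>Q. Q * X"] that by (simp add: mult_mat_assoc del: mat_diag_diag)
  have "Z * ((U * ?S) * mat_adjoint (U * ?S)) * Z = Z" unfolding Z
    by (simp add: mult_mat_assoc mat_adjoint_mult UU D' del: mat_diag_diag)
  moreover have "U * ?S \<in> carrier_mat n n" by (intro carrier_matI) simp_all
  ultimately show ?thesis using that by blast
qed

section \<open>Rank-one decomposition along an arc of frequencies\<close>

text \<open>The map \<open>t \<mapsto> (\<omega> + t) / (1 + t \<omega>)\<close> with \<open>\<omega> = e\<^sup>j\<^sup>\<theta>\<close> sends the half-line \<open>[0, \<infinity>]\<close> to the arc of the
unit circle that joins \<open>\<omega>\<close> to its conjugate through \<open>1\<close>.\<close>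

lemma arc_moebius:
  fixes t \<theta> :: real
  assumes t: "0 \<le> t" and \<theta>: "0 < \<theta>" "\<theta> < pi"
  shows "1 + of_real t * cis \<theta> \<noteq> 0"
    and "\<exists>\<phi>\<in>{-\<theta>..\<theta>}. cis \<theta> + of_real t = cis \<phi> * (1 + of_real t * cis \<theta>)"
proof -
  define s where "s = 1 + of_real t * cis \<theta>"
  have s0: "s \<noteq> 0"
  proof (cases "t = 0")
    case False
    hence "Im s \<noteq> 0" using sin_gt_zero[OF \<theta>] by (simp add: s_def)
    thus ?thesis by auto
  qed (simp add: s_def)
  thus "1 + of_real t * cis \<theta> \<noteq> 0" by (simp add: s_def)
  define q where "q = (cis \<theta> + of_real t) / s"
  \<comment> \<open>Numerator and denominator have the same modulus, so \<open>q\<close> lies on the unit circle.\<close>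
  have "cis \<theta> + of_real t = cis \<theta> * cnj s"
    by (simp add: s_def algebra_simps cis_mult cis_cnj)
  hence q1: "cmod q = 1" using s0 by (simp add: q_def norm_divide norm_mult)
  have re: "Re q = (2 * t + (1 + t\<^sup>2) * cos \<theta>) / (1 + 2 * t * cos \<theta> + t\<^sup>2)"
  proof -
    have "(Re s)\<^sup>2 + (Im s)\<^sup>2 = 1 + 2 * t * cos \<theta> + t\<^sup>2 * ((cos \<theta>)\<^sup>2 + (sin \<theta>)\<^sup>2)"
      by (simp add: s_def power2_eq_square algebra_simps del: sin_cos_squared_add sin_cos_squared_add2 sin_cos_squared_add3)
    moreover have "(cos \<theta> + t) * Re s + sin \<theta> * Im s =
        t * (1 + ((cos \<theta>)\<^sup>2 + (sin \<theta>)\<^sup>2)) + (1 + t\<^sup>2) * cos \<theta>"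
      by (simp add: s_def power2_eq_square algebra_simps del: sin_cos_squared_add sin_cos_squared_add2 sin_cos_squared_add3)
    ultimately show ?thesis by (simp add: q_def Re_divide)
  qed
  have pos: "0 < 1 + 2 * t * cos \<theta> + t\<^sup>2"
  proof -
    have "0 < (sin \<theta>)\<^sup>2 + (cos \<theta> + t)\<^sup>2" using sin_gt_zero[OF \<theta>] by (simp add: add_pos_nonneg)
    also have "\<dots> = 1 + 2 * t * cos \<theta> + t\<^sup>2" by (simp add: sin_squared_eq power2_sum algebra_simps)
    finally show ?thesis .
  qed
  have "cos \<theta> * (1 + 2 * t * cos \<theta> + t\<^sup>2) \<le> 2 * t + (1 + t\<^sup>2) * cos \<theta>"
  proof -
    have "t * (cos \<theta>)\<^sup>2 \<le> t * 1" using t by (intro mult_left_mono) (auto simp: abs_square_le_1)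
    thus ?thesis by (simp add: algebra_simps power2_eq_square)
  qed
  hence "cos \<theta> \<le> Re q" unfolding re using pos by (simp add: pos_le_divide_eq)
  moreover have qA: "q = cis (Arg q)" using q1 by (metis cis_Arg div_by_1 norm_zero of_real_1 sgn_eq zero_neq_one)
  ultimately have "cos \<theta> \<le> cos \<bar>Arg q\<bar>" by (metis cis.sel(1) cos_abs_real)
  hence "\<bar>Arg q\<bar> \<le> \<theta>" 
    using cos_mono_le_eq[of \<theta> "\<bar>Arg q\<bar>"] \<theta> Arg_bounded[of q] by auto
  moreover have "cis \<theta> + of_real t = cis (Arg q) * s" using s0 qA by (metis q_def nonzero_divide_eq_eq)
  ultimately show "\<exists>\<phi>\<in>{-\<theta>..\<theta>}. cis \<theta> + of_real t = cis \<phi> * (1 + of_real t * cis \<theta>)"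
    by (intro bexI[of _ "Arg q"]) (auto simp: s_def)
qed

lemma cscalar_prod_add_mat:
  assumes "S \<in> carrier_mat n n" "T \<in> carrier_mat n n" "v \<in> carrier_vec n"
  shows "((S + c \<cdot>\<^sub>m T) *\<^sub>v v) \<bullet>c v = (S *\<^sub>v v) \<bullet>c v + c * ((T *\<^sub>v v) \<bullet>c v)"
proof -
  have "(S + c \<cdot>\<^sub>m T) *\<^sub>v v = S *\<^sub>v v + c \<cdot>\<^sub>v (T *\<^sub>v v)"
    using assms by (intro eq_vecI) (auto simp: scalar_prod_def algebra_simps sum.distrib sum_distrib_left)
  moreover have "T *\<^sub>v v \<in> carrier_vec n" "S *\<^sub>v v \<in> carrier_vec n" using assms by auto
  ultimately show ?thesis using assms
    by (simp add: add_scalar_prod_distrib[of _ n] smult_scalar_prod_distrib[of _ n])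
qed

text \<open>Put \<open>\<omega> = e\<^sup>j\<^sup>\<theta>\<close>, \<open>X = G - \<omega> F\<close> and \<open>Y = F - \<omega> G\<close>. Since \<open>F u = e\<^sup>j\<^sup>\<phi> G u\<close> with
\<open>\<bar>\<phi>\<bar> \<le> \<theta>\<close> follows from \<open>Y u = t X u\<close> with \<open>t \<ge> 0\<close>, it suffices to find a positive semidefinite
\<open>T\<close> with \<open>X T = Y\<close> and to diagonalize it. The first hypothesis gives
\<open>X Y\<^sup>* = F G\<^sup>* + G F\<^sup>* - 2 cos \<theta> G G\<^sup>*\<close>, which is positive semidefinite by the second, and
\<open>T = Y\<^sup>* W Y\<close> has the required property if \<open>W\<close> is the pseudo-inverse of \<open>X Y\<^sup>*\<close> and the kernel of
\<open>X Y\<^sup>*\<close> is contained in that of \<open>Y\<^sup>*\<close>. The strict inequality \<open>\<theta>0 < \<theta>\<close> is what guarantees this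
inclusion: it leaves a positive multiple of \<open>G G\<^sup>*\<close> inside \<open>X Y\<^sup>*\<close>.\<close>

lemma unitary_pencil:
  fixes F G :: "complex mat" and \<theta>0 \<theta> :: real
  assumes F: "F \<in> carrier_mat n N" and G: "G \<in> carrier_mat n N"
    and eq: "F * mat_adjoint F = G * mat_adjoint G"
    and psd: "psd (F * mat_adjoint G + G * mat_adjoint F - complex_of_real (2 * cos \<theta>0) \<cdot>\<^sub>m (G * mat_adjoint G))"
    and \<theta>: "0 < \<theta>0" "\<theta>0 < \<theta>" "\<theta> < pi"
  obtains U where "unitary_mat N U"
    "\<And>i. i < N \<Longrightarrow> \<exists>\<phi>\<in>{-\<theta>..\<theta>}. F *\<^sub>v col U i = cis \<phi> \<cdot>\<^sub>v (G *\<^sub>v col U i)"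
proof -
  note dims [simp] = carrier_matD[OF F] carrier_matD[OF G]
  define \<omega> where "\<omega> = cis \<theta>"
  define \<delta> where "\<delta> = 2 * (cos \<theta>0 - cos \<theta>)"
  have \<delta>: "0 < \<delta>" using cos_monotone_0_pi[of \<theta>0 \<theta>] \<theta> by (simp add: \<delta>_def)
  define X where "X = G - \<omega> \<cdot>\<^sub>m F"
  define Y where "Y = F - \<omega> \<cdot>\<^sub>m G"
  define S where "S = F * mat_adjoint G + G * mat_adjoint F - complex_of_real (2 * cos \<theta>0) \<cdot>\<^sub>m (G * mat_adjoint G)"
  define Z where "Z = X * mat_adjoint Y"
  have Xc: "X \<in> carrier_mat n N" and Yc: "Y \<in> carrier_mat n N" and Sc: "S \<in> carrier_mat n n"
    and Zc: "Z \<in> carrier_mat n n"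
    by (intro carrier_matI; simp add: X_def Y_def S_def Z_def)+
  have [simp]: "dim_row X = n" "dim_col X = N" "dim_row Y = n" "dim_col Y = N" "dim_row Z = n" "dim_col Z = n"
    using Xc Yc Zc by auto
  have Z: "Z = S + complex_of_real \<delta> \<cdot>\<^sub>m (G * mat_adjoint G)"
  proof (rule eq_matI)
    fix i j assume "i < dim_row (S + complex_of_real \<delta> \<cdot>\<^sub>m (G * mat_adjoint G))"
      "j < dim_col (S + complex_of_real \<delta> \<cdot>\<^sub>m (G * mat_adjoint G))"
    hence ij: "i < n" "j < n" by auto
    define p where "p P Q = (\<Sum>k<N. P $$ (i, k) * cnj (Q $$ (j, k)))" for P Q :: "complex mat"
    have p: "(P * mat_adjoint Q) $$ (i, j) = p P Q" if "P \<in> carrier_mat n N" "Q \<in> carrier_mat n N" for P Q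
      using that ij by (simp add: p_def scalar_prod_def atLeast0LessThan)
    have ww: "\<omega> * cnj \<omega> = 1" by (simp add: \<omega>_def cis_cnj cis_mult)
    have w2: "\<omega> + cnj \<omega> = complex_of_real (2 * cos \<theta>)" by (simp add: \<omega>_def complex_eq_iff)
    have "p X Y = (\<Sum>k<N. (G $$ (i, k) - \<omega> * F $$ (i, k)) * cnj (F $$ (j, k) - \<omega> * G $$ (j, k)))"
      using ij by (simp add: p_def X_def Y_def)
    also have "\<dots> = p G F - cnj \<omega> * p G G - \<omega> * p F F + (\<omega> * cnj \<omega>) * p F G"
      by (simp add: p_def sum_distrib_left sum_subtractf sum.distrib algebra_simps)
    also have "p F F = p G G" using arg_cong[OF eq, of "\<lambda>Q. Q $$ (i, j)"] F G by (simp add: p)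
    finally have "p X Y = p G F + p F G - (\<omega> + cnj \<omega>) * p G G" by (simp add: ww algebra_simps)
    hence "p X Y = p G F + p F G - complex_of_real (2 * cos \<theta>) * p G G" unfolding w2 .
    hence "p X Y = p F G + p G F - complex_of_real (2 * cos \<theta>0) * p G G + complex_of_real \<delta> * p G G"
      by (simp add: \<delta>_def algebra_simps)
    moreover have "(S + complex_of_real \<delta> \<cdot>\<^sub>m (G * mat_adjoint G)) $$ (i, j) =
       p F G + p G F - complex_of_real (2 * cos \<theta>0) * p G G + complex_of_real \<delta> * p G G"
      using ij F G by (simp add: S_def p del: index_mult_mat(1))
    ultimately show "Z $$ (i, j) = (S + complex_of_real \<delta> \<cdot>\<^sub>m (G * mat_adjoint G)) $$ (i, j)"
      unfolding Z_def p[OF Xc Yc] by (simp only:)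
  qed (simp_all)
  have GGc: "G * mat_adjoint G \<in> carrier_mat n n" by (intro carrier_matI) simp_all
  have form: "Re ((Z *\<^sub>v v) \<bullet>c v) = Re ((S *\<^sub>v v) \<bullet>c v) + \<delta> * norm_sq (mat_adjoint G *\<^sub>v v)"
    if "v \<in> carrier_vec n" for v
    unfolding Z cscalar_prod_add_mat[OF Sc GGc that] quadratic_form_gram[OF G that] by simp
  note S = psdD[OF psd[folded S_def] Sc]
  have Zh: "mat_adjoint Z = Z"
    unfolding Z by (subst mat_adjoint_add[OF Sc]) (use GGc in \<open>auto simp: S mat_adjoint_smult mat_adjoint_mult\<close>)
  have Zpsd: "psd Z"
    using Zc Zh S(2) \<delta> by (intro psdI[of _ n]) (simp_all add: form)
  have ker: "mat_adjoint Y *\<^sub>v v = 0\<^sub>v N" if v: "v \<in> carrier_vec n" and Zv: "Z *\<^sub>v v = 0\<^sub>v n" for v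
  proof -
    have "Re ((Z *\<^sub>v v) \<bullet>c v) = 0" using v unfolding Zv by simp
    hence "\<delta> * norm_sq (mat_adjoint G *\<^sub>v v) \<le> 0" using form[OF v] S(2)[OF v] by simp
    hence nG: "norm_sq (mat_adjoint G *\<^sub>v v) = 0"
      using \<delta> norm_sq_nonneg[of "mat_adjoint G *\<^sub>v v"] by (simp add: mult_le_0_iff)
    \<comment> \<open>The two Gram matrices agree, so \<open>F\<^sup>* v\<close> has the same norm as \<open>G\<^sup>* v\<close>.\<close>
    have nF: "norm_sq (mat_adjoint F *\<^sub>v v) = 0"
      using nG quadratic_form_gram[OF F v] quadratic_form_gram[OF G v] by (simp add: eq)
    have "mat_adjoint G *\<^sub>v v \<in> carrier_vec N" "mat_adjoint F *\<^sub>v v \<in> carrier_vec N"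
      by (intro carrier_vecI; simp)+
    hence "mat_adjoint G *\<^sub>v v = 0\<^sub>v N" "mat_adjoint F *\<^sub>v v = 0\<^sub>v N"
      using nG nF norm_sq_eq_0 by blast+
    moreover have "mat_adjoint Y *\<^sub>v v = mat_adjoint F *\<^sub>v v - cnj \<omega> \<cdot>\<^sub>v (mat_adjoint G *\<^sub>v v)"
      using v by (intro eq_vecI) (auto simp: Y_def scalar_prod_def algebra_simps sum_subtractf sum_distrib_left)
    ultimately show ?thesis by (auto intro!: eq_vecI)
  qed
  obtain R where R: "R \<in> carrier_mat n n" and ZRZ: "Z * (R * mat_adjoint R) * Z = Z"
    using psd_generalized_inverse[OF Zpsd Zc] .
  note [simp] = carrier_matD[OF R]
  \<comment> \<open>For every \<open>v\<close>, the vector \<open>(R R\<^sup>* Z) v - v\<close> lies in the kernel of \<open>Z\<close>, hence in that of \<open>Y\<^sup>*\<close>.\<close>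
  have YRZ: "mat_adjoint Y * (R * mat_adjoint R) * Z = mat_adjoint Y"
  proof (rule mat_eqI_vec[of _ N n])
    fix v :: "complex vec" assume v: "v \<in> carrier_vec n"
    define u where "u = (R * mat_adjoint R) *\<^sub>v (Z *\<^sub>v v)"
    have u: "u \<in> carrier_vec n" by (intro carrier_vecI) (simp add: u_def)
    have "Z *\<^sub>v u = Z *\<^sub>v v"
      using arg_cong[OF ZRZ, of "\<lambda>Q. Q *\<^sub>v v"] v by (simp add: u_def mult_mat_vec_assoc)
    hence "Z *\<^sub>v (u - v) = 0\<^sub>v n" using u v Zc by (simp add: mult_mat_vec_minus)
    hence "mat_adjoint Y *\<^sub>v (u - v) = 0\<^sub>v N" using ker[of "u - v"] u v by auto
    hence "mat_adjoint Y *\<^sub>v u - mat_adjoint Y *\<^sub>v v = 0\<^sub>v N" using u v by (simp add: mult_mat_vec_minus)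
    hence "mat_adjoint Y *\<^sub>v u = mat_adjoint Y *\<^sub>v v" by (rule vec_eq_if_minus_eq_0) simp_all
    thus "(mat_adjoint Y * (R * mat_adjoint R) * Z) *\<^sub>v v = mat_adjoint Y *\<^sub>v v"
      using v by (simp add: u_def mult_mat_vec_assoc)
  qed (auto intro!: carrier_matI)
  define T where "T = (mat_adjoint Y * R) * mat_adjoint (mat_adjoint Y * R)"
  have Tc: "T \<in> carrier_mat N N" by (intro carrier_matI) (simp_all add: T_def)
  have Tpsd: "psd T" unfolding T_def by (rule psd_gram[of _ N n]) (auto intro!: carrier_matI)
  \<comment> \<open>This is the adjoint of the previous identity, because \<open>Z\<close> is Hermitian.\<close>
  have XT: "X * T = Y"
  proof -
    have "X * T = Z * (R * mat_adjoint R) * Y" by (simp add: T_def Z_def mult_mat_assoc mat_adjoint_mult)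
    also have "\<dots> = mat_adjoint (mat_adjoint Y * (R * mat_adjoint R) * Z)"
      by (simp add: mult_mat_assoc mat_adjoint_mult Zh)
    finally show ?thesis by (simp add: YRZ)
  qed
  obtain U t where U: "unitary_mat N U" and t: "\<And>i. i < N \<Longrightarrow> 0 \<le> t i"
    and TU: "T = U * mat_diag N (\<lambda>i. complex_of_real (t i)) * mat_adjoint U"
    using psd_diagonalize[OF Tpsd Tc] by metis
  note [simp] = unitary_mat_dim[OF U]
  have "\<exists>\<phi>\<in>{-\<theta>..\<theta>}. F *\<^sub>v col U i = cis \<phi> \<cdot>\<^sub>v (G *\<^sub>v col U i)" if i: "i < N" for i
  proof -
    define u where "u = col U i"
    define f where "f = F *\<^sub>v u"
    define g where "g = G *\<^sub>v u"
    have u: "u \<in> carrier_vec N" using i by (auto simp: u_def intro: carrier_vecI)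
    have fg: "f \<in> carrier_vec n" "g \<in> carrier_vec n" by (auto simp: f_def g_def intro: carrier_vecI)
    have "T *\<^sub>v u = complex_of_real (t i) \<cdot>\<^sub>v u"
      unfolding TU u_def by (rule diagonalized_eigenvector[OF U i])
    hence "Y *\<^sub>v u = complex_of_real (t i) \<cdot>\<^sub>v (X *\<^sub>v u)"
      using u Tc by (simp add: XT[symmetric] mult_mat_vec_assoc mult_mat_vec_smult)
    moreover have "Y *\<^sub>v u = f - \<omega> \<cdot>\<^sub>v g" "X *\<^sub>v u = g - \<omega> \<cdot>\<^sub>v f"
      using u by (intro eq_vecI;
        simp add: X_def Y_def f_def g_def scalar_prod_def algebra_simps sum_subtractf sum_distrib_left)+
    ultimately have eq: "f - \<omega> \<cdot>\<^sub>v g = complex_of_real (t i) \<cdot>\<^sub>v (g - \<omega> \<cdot>\<^sub>v f)" by simp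
    have e: "f $ k - \<omega> * g $ k = complex_of_real (t i) * (g $ k - \<omega> * f $ k)" if "k < n" for k
      using that fg arg_cong[OF eq, of "\<lambda>x. x $ k"] carrier_vecD[OF fg(1)] carrier_vecD[OF fg(2)] by simp
    obtain \<phi> where \<phi>: "\<phi> \<in> {-\<theta>..\<theta>}" and
      q: "cis \<theta> + of_real (t i) = cis \<phi> * (1 + of_real (t i) * cis \<theta>)"
      using arc_moebius(2)[OF t[OF i], of \<theta>] \<theta> by auto
    have nz: "1 + of_real (t i) * cis \<theta> \<noteq> 0" using arc_moebius(1)[OF t[OF i], of \<theta>] \<theta> by auto
    have "f $ k = cis \<phi> * g $ k" if "k < n" for k
    proof -
      have "(1 + of_real (t i) * cis \<theta>) * f $ k = (cis \<theta> + of_real (t i)) * g $ k"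
        using e[OF that] by (simp add: \<omega>_def algebra_simps)
      also have "\<dots> = (1 + of_real (t i) * cis \<theta>) * (cis \<phi> * g $ k)" by (simp add: q)
      finally show ?thesis using nz by simp
    qed
    hence "f = cis \<phi> \<cdot>\<^sub>v g" using fg by (intro eq_vecI) auto
    thus ?thesis using \<phi> by (auto simp: f_def g_def u_def)
  qed
  with U that show ?thesis by blast
qed

text \<open>The columns of \<open>L\<close> are the vectors of the decomposition \<open>V = \<Sum>\<^sub>i v\<^sub>i v\<^sub>i\<^sup>*\<close>. Starting from any factor \<open>M\<close>
with \<open>V = M M\<^sup>*\<close>, they arise by rotating \<open>M\<close> with the unitary matrix of lemma \<open>unitary_pencil\<close>.\<close>

lemma psd_rank_one_decomposition:
  fixes F G V :: "complex mat" and \<theta>0 \<theta> :: real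
  assumes F: "F \<in> carrier_mat n N" and G: "G \<in> carrier_mat n N"
    and V: "psd V" "V \<in> carrier_mat N N"
    and eq: "G * V * mat_adjoint G = F * V * mat_adjoint F"
    and le: "loewner_le (complex_of_real (2 * cos \<theta>0) \<cdot>\<^sub>m (G * V * mat_adjoint G))
                    (F * V * mat_adjoint G + G * V * mat_adjoint F)"
    and \<theta>: "0 < \<theta>0" "\<theta>0 < \<theta>" "\<theta> < pi"
  obtains L where "L \<in> carrier_mat N N" "V = L * mat_adjoint L"
    "\<And>i. i < N \<Longrightarrow> \<exists>\<phi>\<in>{-\<theta>..\<theta>}. F *\<^sub>v col L i = cis \<phi> \<cdot>\<^sub>v (G *\<^sub>v col L i)"
proof -
  obtain M where M: "M \<in> carrier_mat N N" and VM: "V = M * mat_adjoint M"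
    using psd_factorization[OF V] .
  note [simp] = carrier_matD[OF F] carrier_matD[OF G] carrier_matD[OF M]
  have gram: "P * V * mat_adjoint Q = (P * M) * mat_adjoint (Q * M)"
    if "dim_col P = N" "dim_col Q = N" for P Q
    using that by (simp add: VM mult_mat_assoc mat_adjoint_mult)
  have FM: "F * M \<in> carrier_mat n N" and GM: "G * M \<in> carrier_mat n N"
    by (intro carrier_matI; simp)+
  have FF: "(F * M) * mat_adjoint (F * M) = (G * M) * mat_adjoint (G * M)"
    using eq by (simp add: gram)
  obtain U where U: "unitary_mat N U"
    and u: "\<And>i. i < N \<Longrightarrow> \<exists>\<phi>\<in>{-\<theta>..\<theta>}. (F * M) *\<^sub>v col U i = cis \<phi> \<cdot>\<^sub>v ((G * M) *\<^sub>v col U i)"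
    using unitary_pencil[OF FM GM FF _ \<theta>] le by (auto simp: gram loewner_le_def)
  have Uc: "U \<in> carrier_mat N N" using U by (simp add: unitary_mat_def)
  note [simp] = unitary_mat_dim[OF U]
  have "(M * U) * mat_adjoint (M * U) = M * (U * mat_adjoint U) * mat_adjoint M"
    by (simp add: mult_mat_assoc mat_adjoint_mult)
  hence "V = (M * U) * mat_adjoint (M * U)" using U by (simp add: VM unitary_mat_def)
  moreover have "M * U \<in> carrier_mat N N" by (intro carrier_matI) simp_all
  moreover have "\<exists>\<phi>\<in>{-\<theta>..\<theta>}. F *\<^sub>v col (M * U) i = cis \<phi> \<cdot>\<^sub>v (G *\<^sub>v col (M * U) i)" if "i < N" for i
    using u[OF that] that by (simp add: mult_mat_vec_assoc col_mult2[OF M Uc])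
  ultimately show ?thesis using that by blast
qed

section \<open>Continuity of the largest gain\<close>

definition continuous_mat :: "nat \<Rightarrow> nat \<Rightarrow> (real \<Rightarrow> complex mat) \<Rightarrow> bool" where
  "continuous_mat n m M \<longleftrightarrow> (\<forall>t. M t \<in> carrier_mat n m) \<and>
     (\<forall>i<n. \<forall>j<m. \<forall>t. isCont (\<lambda>t. M t $$ (i, j)) t)"

lemma continuous_matD:
  assumes "continuous_mat n m M"
  shows "M t \<in> carrier_mat n m" "dim_row (M t) = n" "dim_col (M t) = m"
    "i < n \<Longrightarrow> j < m \<Longrightarrow> isCont (\<lambda>t. M t $$ (i, j)) t"
  using assms unfolding continuous_mat_def by auto

lemma continuous_mat_const: "A \<in> carrier_mat n m \<Longrightarrow> continuous_mat n m (\<lambda>_. A)"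
  by (simp add: continuous_mat_def)

lemma continuous_mat_add:
  assumes "continuous_mat n m M" "continuous_mat n m N"
  shows "continuous_mat n m (\<lambda>t. M t + N t)"
  using assms[THEN continuous_matD(1)] assms[THEN continuous_matD(2)] assms[THEN continuous_matD(3)]
    assms[THEN continuous_matD(4)]
  by (auto simp: continuous_mat_def)

lemma continuous_mat_mult:
  assumes "continuous_mat n m M" "continuous_mat m k N"
  shows "continuous_mat n k (\<lambda>t. M t * N t)"
proof -
  note [simp] = assms[THEN continuous_matD(2)] assms[THEN continuous_matD(3)]
  have "(M t * N t) $$ (i, j) = (\<Sum>p<m. M t $$ (i, p) * N t $$ (p, j))" if "i < n" "j < k" for i j t
    using that by (simp add: scalar_prod_def atLeast0LessThan)
  moreover have "isCont (\<lambda>t. \<Sum>p<m. M t $$ (i, p) * N t $$ (p, j)) t" if "i < n" "j < k" for i j t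
    using that by (intro continuous_intros) (auto intro: assms[THEN continuous_matD(4)])
  ultimately show ?thesis by (auto simp: continuous_mat_def intro!: carrier_matI)
qed

lemma continuous_mat_adjoint:
  assumes "continuous_mat n m M"
  shows "continuous_mat m n (\<lambda>t. mat_adjoint (M t))"
  using continuous_matD[OF assms] 
  by (auto simp: continuous_mat_def intro!: isCont_cnj)

lemma isCont_det:
  assumes "continuous_mat n n M"
  shows "isCont (\<lambda>t. det (M t)) t"
proof -
  have "(\<lambda>t. det (M t)) = (\<lambda>t. \<Sum>p\<in>{p. p permutes {0..<n}}. signof p * (\<Prod>i=0..<n. M t $$ (i, p i)))"
    using det_def'[OF continuous_matD(1)[OF assms]] by auto
  moreover have "isCont (\<lambda>t. \<Sum>p\<in>{p. p permutes {0..<n}}. signof p * (\<Prod>i=0..<n. M t $$ (i, p i))) t"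
    by (intro continuous_intros continuous_matD(4)[OF assms]) (auto dest: permutes_in_image)
  ultimately show ?thesis by simp
qed

text \<open>Cofactors are determinants, hence polynomials in the entries. Together with Cramer's rule this
is how continuity reaches the inverse of a matrix.\<close>

lemma continuous_mat_adj_mat:
  assumes "continuous_mat n n M"
  shows "continuous_mat n n (\<lambda>t. adj_mat (M t))"
proof -
  note [simp] = continuous_matD(2,3)[OF assms]
  have "isCont (\<lambda>t. adj_mat (M t) $$ (i, j)) t" if ij: "i < n" "j < n" for i j t
  proof -
    have "continuous_mat (n - 1) (n - 1) (\<lambda>t. mat_delete (M t) j i)"
      using ij by (auto simp: continuous_mat_def mat_delete_def intro!: continuous_matD(4)[OF assms])
    hence "isCont (\<lambda>t. (- 1) ^ (j + i) * det (mat_delete (M t) j i)) t"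
      by (intro continuous_intros isCont_det)
    thus ?thesis using ij by (simp add: adj_mat_def cofactor_def)
  qed
  thus ?thesis using adj_mat(1)[OF continuous_matD(1)[OF assms]] by (auto simp: continuous_mat_def)
qed

lemma norm_entry_le_norm_sq:
  assumes "norm_sq u = 1" "u \<in> carrier_vec n" "i < n"
  shows "cmod (u $ i) \<le> 1"
proof -
  have "(cmod (u $ i))\<^sup>2 \<le> norm_sq u" unfolding norm_sq_def using assms by (intro member_le_sum) auto
  thus ?thesis using assms(1) using abs_square_le_1[of "cmod (u $ i)"] by simp
qed

lemma quadratic_form_diff_le:
  assumes "H \<in> carrier_mat n n" "H' \<in> carrier_mat n n" "u \<in> carrier_vec n" "norm_sq u = 1"
  shows "Re ((H *\<^sub>v u) \<bullet>c u) \<le> Re ((H' *\<^sub>v u) \<bullet>c u) + (\<Sum>i<n. \<Sum>j<n. cmod (H $$ (i, j) - H' $$ (i, j)))"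
proof -
  have form: "(Q *\<^sub>v u) \<bullet>c u = (\<Sum>i<n. \<Sum>j<n. Q $$ (i, j) * u $ j * cnj (u $ i))"
    if "Q \<in> carrier_mat n n" for Q
    using that assms by (simp add: scalar_prod_def sum_distrib_right atLeast0LessThan)
  have "Re ((H *\<^sub>v u) \<bullet>c u) - Re ((H' *\<^sub>v u) \<bullet>c u) =
      Re (\<Sum>i<n. \<Sum>j<n. (H $$ (i, j) - H' $$ (i, j)) * u $ j * cnj (u $ i))"
    using assms by (simp add: form sum_subtractf algebra_simps)
  also have "\<dots> \<le> cmod (\<Sum>i<n. \<Sum>j<n. (H $$ (i, j) - H' $$ (i, j)) * u $ j * cnj (u $ i))"
    by (rule complex_Re_le_cmod)
  also have "\<dots> \<le> (\<Sum>i<n. \<Sum>j<n. cmod ((H $$ (i, j) - H' $$ (i, j)) * u $ j * cnj (u $ i)))"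
    by (rule order_trans[OF norm_sum]) (intro sum_mono norm_sum)
  also have "\<dots> \<le> (\<Sum>i<n. \<Sum>j<n. cmod (H $$ (i, j) - H' $$ (i, j)))"
  proof (intro sum_mono)
    fix i j assume "i \<in> {..<n}" "j \<in> {..<n}"
    hence "cmod (u $ j) * cmod (u $ i) \<le> 1 * 1"
      using norm_entry_le_norm_sq[OF assms(4,3)] by (intro mult_mono) auto
    hence "cmod (H $$ (i, j) - H' $$ (i, j)) * (cmod (u $ j) * cmod (u $ i)) \<le> cmod (H $$ (i, j) - H' $$ (i, j)) * 1"
      by (intro mult_left_mono) auto
    thus "cmod ((H $$ (i, j) - H' $$ (i, j)) * u $ j * cnj (u $ i)) \<le> cmod (H $$ (i, j) - H' $$ (i, j))"
      by (simp add: norm_mult mult.assoc)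
  qed
  finally show ?thesis by simp
qed

text \<open>The function \<open>\<mu>\<close> is the largest eigenvalue of \<open>H t = (K t)\<^sup>* (K t)\<close>. It inherits continuity from the
entries of \<open>H\<close>: testing the quadratic form of \<open>H s\<close> at the maximizer for \<open>s\<close> shows that \<open>\<mu> s\<close> exceeds
\<open>\<mu> t\<close> by at most the sum of the moduli of the entries of \<open>H s - H t\<close>, and the roles of \<open>s\<close> and \<open>t\<close> can be
exchanged.\<close>

lemma continuous_max_gain:
  assumes K: "continuous_mat l m K" and m: "1 \<le> m"
  obtains \<mu> u where "\<And>t. u t \<in> carrier_vec m" "\<And>t. norm_sq (u t) = 1" "\<And>t. norm_sq (K t *\<^sub>v u t) = \<mu> t"
    "\<And>t w. w \<in> carrier_vec m \<Longrightarrow> norm_sq (K t *\<^sub>v w) \<le> \<mu> t * norm_sq w" "\<And>t. isCont \<mu> t"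
proof -
  define H where "H t = mat_adjoint (K t) * K t" for t
  have Hcont: "continuous_mat m m H" unfolding H_def
    by (rule continuous_mat_mult[OF continuous_mat_adjoint[OF K] K])
  note Hc = continuous_matD(1)[OF Hcont]
  note [simp] = continuous_matD(2,3)[OF K]
  have Hh: "mat_adjoint (H t) = H t" for t by (simp add: H_def mat_adjoint_mult)
  have gain: "norm_sq (K t *\<^sub>v w) = Re ((H t *\<^sub>v w) \<bullet>c w)" if "w \<in> carrier_vec m" for t w
    using norm_sq_mult_mat_vec[OF continuous_matD(1)[OF K] that, of t] by (metis H_def Re_complex_of_real)
  define \<mu> where "\<mu> t v = Re ((H t *\<^sub>v v) \<bullet>c v)" for t v
  have "\<exists>v. v \<in> carrier_vec m \<and> norm_sq v = 1 \<and> (\<forall>w\<in>carrier_vec m. \<mu> t w \<le> \<mu> t v * norm_sq w)" for t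
    using hermitian_rayleigh[OF Hc Hh m, of t] unfolding \<mu>_def by (metis Re_complex_of_real)
  then obtain u where u: "u t \<in> carrier_vec m" "norm_sq (u t) = 1"
    "\<And>w. w \<in> carrier_vec m \<Longrightarrow> \<mu> t w \<le> \<mu> t (u t) * norm_sq w" for t
    by metis
  define e where "e s t = (\<Sum>i<m. \<Sum>j<m. cmod (H s $$ (i, j) - H t $$ (i, j)))" for s t
  have le: "\<mu> s (u s) \<le> \<mu> t (u t) + e s t" for s t
    using quadratic_form_diff_le[OF Hc[of s] Hc[of t] u(1)[of s] u(2)[of s]] u(3)[OF u(1)[of s], of t]
    by (simp add: u(2) \<mu>_def e_def)
  have sym: "e s t = e t s" for s t by (simp add: e_def norm_minus_commute)
  have "isCont (\<lambda>t. \<mu> t (u t)) t" for t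
  proof -
    have "isCont (\<lambda>s. e s t) t" unfolding e_def
      by (intro continuous_intros) (auto intro: continuous_matD(4)[OF Hcont])
    hence "((\<lambda>s. e s t) \<longlongrightarrow> e t t) (at t)" by (simp add: isCont_def)
    hence e0: "((\<lambda>s. e s t) \<longlongrightarrow> 0) (at t)" by (simp add: e_def)
    have "((\<lambda>s. \<mu> s (u s) - \<mu> t (u t)) \<longlongrightarrow> 0) (at t)"
      
    proof (rule tendsto_0_le[OF e0, where K = 1], intro always_eventually allI)
      fix s show "norm (\<mu> s (u s) - \<mu> t (u t)) \<le> norm (e s t) * 1"
        using le[of s t] le[of t s] sym[of s t] by (auto simp: abs_le_iff)
    qed
    thus ?thesis by (simp add: isCont_def LIM_zero_cancel)
  qed
  moreover have "norm_sq (K t *\<^sub>v u t) = \<mu> t (u t)" for t using u(1) by (simp add: gain \<mu>_def)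
  moreover have "norm_sq (K t *\<^sub>v w) \<le> \<mu> t (u t) * norm_sq w" if "w \<in> carrier_vec m" for t w
    using u(3)[OF that] by (simp add: gain that \<mu>_def)
  ultimately show ?thesis using that[of u "\<lambda>t. \<mu> t (u t)"] u(1,2) by blast
qed

text \<open>Only points near the two end points are new, so continuity there suffices.\<close>

lemma strict_bound_enlarged_interval:
  fixes \<mu> :: "real \<Rightarrow> real"
  assumes cont: "\<And>t. isCont \<mu> t" and bound: "\<And>t. t \<in> {-a..a} \<Longrightarrow> \<mu> t < c" and a: "0 < a" "a < b"
  obtains a' where "a < a'" "a' < b" "\<And>t. t \<in> {-a'..a'} \<Longrightarrow> \<mu> t < c"
proof -
  have ex: "\<exists>d>0. \<forall>t. \<bar>t - s\<bar> < d \<longrightarrow> \<mu> t < c" if "s \<in> {-a..a}" for s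
  proof -
    have "\<forall>\<^sub>F t in at s. \<mu> t < c"
      using cont[of s] bound[OF that] by (auto simp: isCont_def dest: order_tendstoD(2))
    then obtain d where d: "d > 0" "\<And>t. t \<noteq> s \<Longrightarrow> dist t s < d \<Longrightarrow> \<mu> t < c"
      by (auto simp: eventually_at)
    show ?thesis using d bound[OF that] by (intro exI[of _ d]) (auto simp: dist_real_def, metis)
  qed
  obtain d1 where d1: "d1 > 0" "\<And>t. \<bar>t - a\<bar> < d1 \<Longrightarrow> \<mu> t < c" using ex[of a] a by auto
  obtain d2 where d2: "d2 > 0" "\<And>t. \<bar>t - (-a)\<bar> < d2 \<Longrightarrow> \<mu> t < c" using ex[of "-a"] a by auto
  define a' where "a' = a + min (min (d1 / 2) (d2 / 2)) ((b - a) / 2)"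
  have a': "a < a'" "a' < b" "a' - a < d1" "a' - a < d2"
    using d1 d2 a by (auto simp: a'_def min_def field_simps)
  have "\<mu> t < c" if "t \<in> {-a'..a'}" for t
    using that a' d1(2)[of t] d2(2)[of t] bound[of t] by (cases "t > a"; cases "t < -a") auto
  with a' that show ?thesis by blast
qed

section \<open>Steady-state response of a Schur stable system\<close>

lemma pow_smult_mat:
  fixes A :: "complex mat"
  assumes "A \<in> carrier_mat n n"
  shows "(c \<cdot>\<^sub>m A) ^\<^sub>m k = c ^ k \<cdot>\<^sub>m (A ^\<^sub>m k)"
proof (induction k)
  case 0
  show ?case using assms by (intro eq_matI) auto
next
  case (Suc k)
  have p: "A ^\<^sub>m k \<in> carrier_mat n n" using assms by simp
  have "(c \<cdot>\<^sub>m A) ^\<^sub>m Suc k = (c ^ k \<cdot>\<^sub>m (A ^\<^sub>m k)) * (c \<cdot>\<^sub>m A)" by (simp add: Suc)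
  also have "\<dots> = c ^ Suc k \<cdot>\<^sub>m (A ^\<^sub>m Suc k)"
    using assms p carrier_matD[OF assms] carrier_matD[OF p]
    by (intro eq_matI) (auto simp: scalar_prod_def sum_distrib_left ac_simps)
  finally show ?case .
qed

lemma eigenvalue_le_spectral_radius:
  assumes A: "A \<in> carrier_mat n n" "1 \<le> n" and v: "v \<in> carrier_vec n" "v \<noteq> 0\<^sub>v n" "A *\<^sub>v v = a \<cdot>\<^sub>v v"
  shows "cmod a \<le> spectral_radius A"
proof -
  have "eigenvalue A a" using A v by (auto simp: eigenvalue_def eigenvector_def)
  thus ?thesis using spectral_radius_mem_max(2)[OF A(1), of "cmod a"] A(2) by (auto simp: spectrum_def)
qed

text \<open>The powers of a matrix of spectral radius less than one are bounded. Applied to \<open>A / r\<close>, where \<open>r\<close> lies strictly between the spectral radius and one, this gives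
geometric decay.\<close>

lemma schur_stable_powers_decay:
  assumes A: "A \<in> carrier_mat n n" "1 \<le> n" and st: "schur_stable A"
  obtains r c where "0 < r" "r < 1" "0 \<le> c"
    "\<And>k i j. i < n \<Longrightarrow> j < n \<Longrightarrow> cmod ((A ^\<^sub>m k) $$ (i, j)) \<le> c * r ^ k"
proof -
  define r where "r = (1 + spectral_radius A) / 2"
  have sr: "0 \<le> spectral_radius A" "spectral_radius A < 1"
    using spectral_radius_mem_max(1)[OF A(1)] A(2) st by (auto simp: schur_stable_def)
  have r: "0 < r" "r < 1" "spectral_radius A < r" using sr by (auto simp: r_def)
  define A' where "A' = complex_of_real (1 / r) \<cdot>\<^sub>m A"
  have A': "A' \<in> carrier_mat n n" using A by (simp add: A'_def)
  have AA': "A = complex_of_real r \<cdot>\<^sub>m A'" using r by (intro eq_matI) (auto simp: A'_def)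
  have "spectral_radius A' < 1"
  proof -
    obtain a where a: "eigenvalue A' a" "spectral_radius A' = cmod a"
      using spectral_radius_mem_max(1)[OF A'] A(2) by (auto simp: spectrum_def)
    then obtain v where v: "v \<in> carrier_vec n" "v \<noteq> 0\<^sub>v n" "A' *\<^sub>v v = a \<cdot>\<^sub>v v"
      using A' by (auto simp: eigenvalue_def eigenvector_def)
    have "A *\<^sub>v v = complex_of_real r \<cdot>\<^sub>v (A' *\<^sub>v v)"
      using smult_mat_mult_vec[of A' v "complex_of_real r"] carrier_matD[OF A'] v(1) by (simp add: AA'[symmetric])
    hence "A *\<^sub>v v = (complex_of_real r * a) \<cdot>\<^sub>v v" by (simp add: v smult_smult_assoc)
    from eigenvalue_le_spectral_radius[OF A v(1,2) this]
    have "r * cmod a \<le> spectral_radius A" using r by (simp add: norm_mult)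
    hence "cmod a < 1" using r mult_left_mono[of 1 "cmod a" r] by linarith
    thus ?thesis using a by simp
  qed
  then obtain b where b: "\<And>k. norm_bound (A' ^\<^sub>m k) b"
    using spectral_radius_jnf_norm_bound_less_1_upper_triangular[OF A'] by blast
  have bound: "cmod ((A ^\<^sub>m k) $$ (i, j)) \<le> max b 0 * r ^ k" if ij: "i < n" "j < n" for k i j
  proof -
    have d: "dim_row (A ^\<^sub>m k) = n" "dim_col (A ^\<^sub>m k) = n" "dim_row (A' ^\<^sub>m k) = n" "dim_col (A' ^\<^sub>m k) = n"
      using pow_carrier_mat[OF A(1), of k] pow_carrier_mat[OF A', of k] by auto
    have "A ^\<^sub>m k = complex_of_real r ^ k \<cdot>\<^sub>m (A' ^\<^sub>m k)"
      using pow_smult_mat[OF A', of "complex_of_real r" k] by (simp add: AA'[symmetric])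
    hence "cmod ((A ^\<^sub>m k) $$ (i, j)) = r ^ k * cmod ((A' ^\<^sub>m k) $$ (i, j))"
      using ij d r by (simp add: norm_mult norm_power)
    also have "\<dots> \<le> r ^ k * b"
      using b[of k] ij d r by (intro mult_left_mono) (auto simp: norm_bound_def)
    finally have "cmod ((A ^\<^sub>m k) $$ (i, j)) \<le> b * r ^ k" by (simp add: mult.commute)
    also have "\<dots> \<le> max b 0 * r ^ k" using r by (intro mult_right_mono) auto
    finally show ?thesis .
  qed
  show ?thesis by (rule that[OF r(1,2) _ bound]) auto
qed

text \<open>A geometrically decaying error has bounded partial sums, so its Cesaro means vanish.\<close>

lemma mean_power_tendsto:
  assumes r: "0 \<le> r" "r < 1" and h: "\<And>k. \<bar>norm_sq (h k) - a\<bar> \<le> K * r ^ k"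
  shows "mean_power h \<longlonglongrightarrow> a"
proof -
  have K: "0 \<le> K" using h[of 0] by simp
  have sum: "\<bar>\<Sum>k<N. norm_sq (h k) - a\<bar> \<le> K / (1 - r)" for N
  proof -
    have "\<bar>\<Sum>k<N. norm_sq (h k) - a\<bar> \<le> (\<Sum>k<N. K * r ^ k)"
      by (rule order_trans[OF sum_abs]) (intro sum_mono h)
    also have "\<dots> = K * ((1 - r ^ N) / (1 - r))" using r by (simp add: sum_distrib_left[symmetric] sum_gp_strict)
    also have "\<dots> \<le> K * (1 / (1 - r))" using r K by (intro mult_left_mono divide_right_mono) auto
    finally show ?thesis by simp
  qed
  have diff: "mean_power h N - a = 1 / real N * (\<Sum>k<N. norm_sq (h k) - a)" if "0 < N" for N
    using that by (simp add: mean_power_def cscalar_prod_self sum_subtractf field_simps)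
  have "(\<lambda>N. mean_power h N - a) \<longlonglongrightarrow> 0"
  proof (rule tendsto_0_le[where K = "K / (1 - r)"])
    show "(\<lambda>N. 1 / real N) \<longlonglongrightarrow> 0" by (rule lim_1_over_n)
    show "\<forall>\<^sub>F N in sequentially. norm (mean_power h N - a) \<le> norm (1 / real N) * (K / (1 - r))"
    proof (intro eventually_sequentiallyI[of 1])
      fix N :: nat assume "1 \<le> N"
      hence "norm (mean_power h N - a) = norm (1 / real N) * \<bar>\<Sum>k<N. norm_sq (h k) - a\<bar>"
        by (subst diff) (auto simp: abs_mult)
      also have "\<dots> \<le> norm (1 / real N) * (K / (1 - r))" by (intro mult_left_mono sum) auto
      finally show "norm (mean_power h N - a) \<le> norm (1 / real N) * (K / (1 - r))" .
    qed
  qed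
  thus ?thesis by (rule LIM_zero_cancel)
qed

lemma norm_sq_perturbation:
  assumes z: "z \<in> carrier_vec l" and y: "y \<in> carrier_vec l" and c: "cmod c = 1"
    and e: "0 \<le> e" "e \<le> b" "\<And>i. i < l \<Longrightarrow> cmod (y $ i) \<le> e"
  shows "\<bar>norm_sq (c \<cdot>\<^sub>v z - y) - norm_sq z\<bar> \<le> (\<Sum>i<l. 2 * cmod (z $ i) + b) * e"
proof -
  have "norm_sq (c \<cdot>\<^sub>v z - y) - norm_sq z = (\<Sum>i<l. (cmod (c * z $ i - y $ i))\<^sup>2 - (cmod (z $ i))\<^sup>2)"
    using z y by (simp add: norm_sq_def sum_subtractf)
  also have "\<bar>\<dots>\<bar> \<le> (\<Sum>i<l. \<bar>(cmod (c * z $ i - y $ i))\<^sup>2 - (cmod (z $ i))\<^sup>2\<bar>)" by (rule sum_abs)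
  also have "\<dots> \<le> (\<Sum>i<l. (2 * cmod (z $ i) + b) * e)"
  proof (rule sum_mono)
    fix i assume "i \<in> {..<l}"
    hence yi: "cmod (y $ i) \<le> e" using e by auto
    have cz: "cmod (c * z $ i) = cmod (z $ i)" using c by (simp add: norm_mult)
    have 1: "\<bar>cmod (c * z $ i - y $ i) - cmod (z $ i)\<bar> \<le> cmod (y $ i)"
      using norm_triangle_ineq3[of "c * z $ i - y $ i" "c * z $ i"] cz by simp
    have "\<bar>(cmod (c * z $ i - y $ i))\<^sup>2 - (cmod (z $ i))\<^sup>2\<bar>
       = \<bar>cmod (c * z $ i - y $ i) - cmod (z $ i)\<bar> * \<bar>cmod (c * z $ i - y $ i) + cmod (z $ i)\<bar>"
      unfolding abs_mult[symmetric] by (simp add: power2_eq_square algebra_simps)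
    also have "\<dots> \<le> e * (2 * cmod (z $ i) + b)"
    proof (rule mult_mono)
      show "\<bar>cmod (c * z $ i - y $ i) - cmod (z $ i)\<bar> \<le> e" using 1 yi by linarith
      have "\<bar>cmod (c * z $ i - y $ i) + cmod (z $ i)\<bar> = cmod (c * z $ i - y $ i) + cmod (z $ i)" by simp
      thus "\<bar>cmod (c * z $ i - y $ i) + cmod (z $ i)\<bar> \<le> 2 * cmod (z $ i) + b" using 1 yi e(2) by linarith
    qed (use e in auto)
    finally show "\<bar>(cmod (c * z $ i - y $ i))\<^sup>2 - (cmod (z $ i))\<^sup>2\<bar> \<le> (2 * cmod (z $ i) + b) * e"
      by (simp add: mult.commute)
  qed
  finally show ?thesis by (simp only: sum_distrib_right)
qed

locale stable_system =
  fixes A B C D :: "complex mat" and n m l :: nat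
  assumes n: "1 \<le> n" and A: "A \<in> carrier_mat n n" and B: "B \<in> carrier_mat n m"
    and C: "C \<in> carrier_mat l n" and D: "D \<in> carrier_mat l m" and stable: "schur_stable A"
begin

lemmas system_dims [simp] =
  carrier_matD[OF A] carrier_matD[OF B] carrier_matD[OF C] carrier_matD[OF D]

definition pencil :: "real \<Rightarrow> complex mat" where
  "pencil \<theta> = cis \<theta> \<cdot>\<^sub>m 1\<^sub>m n - A"

definition resolvent :: "real \<Rightarrow> complex mat" where
  "resolvent \<theta> = (1 / det (pencil \<theta>)) \<cdot>\<^sub>m adj_mat (pencil \<theta>)"

definition transfer :: "real \<Rightarrow> complex mat" where
  "transfer \<theta> = C * resolvent \<theta> * B + D"

lemma pencil_carrier: "pencil \<theta> \<in> carrier_mat n n"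
  by (intro carrier_matI) (simp_all add: pencil_def)

lemma pencil_mult_vec:
  assumes "x \<in> carrier_vec n"
  shows "pencil \<theta> *\<^sub>v x = cis \<theta> \<cdot>\<^sub>v x - A *\<^sub>v x"
proof -
  have "pencil \<theta> *\<^sub>v x = (cis \<theta> \<cdot>\<^sub>m 1\<^sub>m n) *\<^sub>v x - A *\<^sub>v x"
    unfolding pencil_def using A assms by (intro minus_mult_distrib_mat_vec[of _ n n]) auto
  thus ?thesis using assms by (simp add: smult_mat_mult_vec)
qed

lemma det_pencil: "det (pencil \<theta>) \<noteq> 0"
proof
  assume "det (pencil \<theta>) = 0"
  then obtain v where v: "v \<in> carrier_vec n" "v \<noteq> 0\<^sub>v n" "pencil \<theta> *\<^sub>v v = 0\<^sub>v n"
    using det_0_iff_vec_prod_zero_field[OF pencil_carrier] by auto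
  have "cis \<theta> \<cdot>\<^sub>v v - A *\<^sub>v v = 0\<^sub>v n" using pencil_mult_vec[OF v(1)] v(3) by simp
  from vec_eq_if_minus_eq_0[OF this] have "A *\<^sub>v v = cis \<theta> \<cdot>\<^sub>v v" using v(1) by simp
  from eigenvalue_le_spectral_radius[OF A n v(1,2) this] show False
    using stable by (simp add: schur_stable_def)
qed

lemma resolvent_carrier: "resolvent \<theta> \<in> carrier_mat n n"
  using adj_mat(1)[OF pencil_carrier] by (simp add: resolvent_def)

lemma transfer_carrier: "transfer \<theta> \<in> carrier_mat l m"
  using carrier_matD[OF resolvent_carrier] by (intro carrier_matI) (simp_all add: transfer_def)

lemma resolvent_inverse: "pencil \<theta> * resolvent \<theta> = 1\<^sub>m n" "resolvent \<theta> * pencil \<theta> = 1\<^sub>m n"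
proof -
  note adj = adj_mat[OF pencil_carrier, of \<theta>]
  have "pencil \<theta> * resolvent \<theta> = (1 / det (pencil \<theta>)) \<cdot>\<^sub>m (pencil \<theta> * adj_mat (pencil \<theta>))"
    unfolding resolvent_def by (rule mult_smult_distrib[OF pencil_carrier adj(1)])
  also have "\<dots> = 1\<^sub>m n" unfolding adj(2) using det_pencil[of \<theta>] by (intro eq_matI) auto
  finally show 1: "pencil \<theta> * resolvent \<theta> = 1\<^sub>m n" .
  show "resolvent \<theta> * pencil \<theta> = 1\<^sub>m n"
    by (rule mat_mult_left_right_inverse[OF pencil_carrier resolvent_carrier 1])
qed

text \<open>This equivalence is the link between the two problems: it describes the steady state of a
trajectory and also the state part of each vector in the rank-one decomposition.\<close>

lemma steady_state_iff:
  assumes "x \<in> carrier_vec n" "w \<in> carrier_vec m"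
  shows "A *\<^sub>v x + B *\<^sub>v w = cis \<theta> \<cdot>\<^sub>v x \<longleftrightarrow> x = resolvent \<theta> *\<^sub>v (B *\<^sub>v w)"
proof -
  have Bw: "B *\<^sub>v w \<in> carrier_vec n" using B assms by simp
  have "A *\<^sub>v x + B *\<^sub>v w = cis \<theta> \<cdot>\<^sub>v x \<longleftrightarrow> pencil \<theta> *\<^sub>v x = B *\<^sub>v w"
    unfolding pencil_mult_vec[OF assms(1)]
  proof
    assume *: "A *\<^sub>v x + B *\<^sub>v w = cis \<theta> \<cdot>\<^sub>v x"
    show "cis \<theta> \<cdot>\<^sub>v x - A *\<^sub>v x = B *\<^sub>v w"
      unfolding *[symmetric] using assms by (intro eq_vecI) auto
  next
    assume *: "cis \<theta> \<cdot>\<^sub>v x - A *\<^sub>v x = B *\<^sub>v w"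
    show "A *\<^sub>v x + B *\<^sub>v w = cis \<theta> \<cdot>\<^sub>v x"
      unfolding *[symmetric] using assms by (intro eq_vecI) auto
  qed
  also have "\<dots> \<longleftrightarrow> x = resolvent \<theta> *\<^sub>v (B *\<^sub>v w)"
  proof
    assume *: "pencil \<theta> *\<^sub>v x = B *\<^sub>v w"
    have "x = (resolvent \<theta> * pencil \<theta>) *\<^sub>v x" using assms by (simp add: resolvent_inverse)
    also have "\<dots> = resolvent \<theta> *\<^sub>v (B *\<^sub>v w)"
      using * assoc_mult_mat_vec[OF resolvent_carrier pencil_carrier assms(1)] by simp
    finally show "x = resolvent \<theta> *\<^sub>v (B *\<^sub>v w)" .
  next
    assume "x = resolvent \<theta> *\<^sub>v (B *\<^sub>v w)"
    hence "pencil \<theta> *\<^sub>v x = (pencil \<theta> * resolvent \<theta>) *\<^sub>v (B *\<^sub>v w)"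
      using assoc_mult_mat_vec[OF pencil_carrier resolvent_carrier Bw] by simp
    thus "pencil \<theta> *\<^sub>v x = B *\<^sub>v w" using Bw by (simp add: resolvent_inverse)
  qed
  finally show ?thesis .
qed

lemma transfer_mult_vec:
  assumes "w \<in> carrier_vec m"
  shows "transfer \<theta> *\<^sub>v w = C *\<^sub>v (resolvent \<theta> *\<^sub>v (B *\<^sub>v w)) + D *\<^sub>v w"
proof -
  note [simp] = carrier_matD[OF resolvent_carrier]
  have "transfer \<theta> *\<^sub>v w = (C * resolvent \<theta> * B) *\<^sub>v w + D *\<^sub>v w" unfolding transfer_def
    using assms D by (intro add_mult_distrib_mat_vec[of _ l m]) (auto intro!: carrier_matI)
  thus ?thesis using assms by (simp add: mult_mat_vec_assoc)
qed

lemma continuous_pencil: "continuous_mat n n pencil"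
  using pencil_carrier
  by (auto simp: continuous_mat_def pencil_def cis_conv_exp intro!: continuous_intros)

lemma continuous_transfer: "continuous_mat l m transfer"
proof -
  have "continuous_mat n n resolvent"
  proof -
    note adj = continuous_mat_adj_mat[OF continuous_pencil]
    have "isCont (\<lambda>t. (1 / det (pencil t)) * adj_mat (pencil t) $$ (i, j)) t" if "i < n" "j < n" for i j t
      by (intro continuous_intros isCont_det[OF continuous_pencil] continuous_matD(4)[OF adj] that det_pencil)
    thus ?thesis using resolvent_carrier continuous_matD(2,3)[OF adj]
      by (auto simp: continuous_mat_def resolvent_def)
  qed
  thus ?thesis unfolding transfer_def[abs_def]
    by (intro continuous_mat_add continuous_mat_mult continuous_mat_const) (rule A B C D | assumption)+
qed

text \<open>The steady state \<open>e\<^sup>j\<^sup>\<theta>\<^sup>k x\<^sub>s\<close> solves the recursion, and subtracting the solution \<open>A\<^sup>k x\<^sub>s\<close> of the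
homogeneous recursion corrects the initial value to zero.\<close>

lemma trajectory_closed_form:
  assumes ws: "ws \<in> carrier_vec m" and x0: "x 0 = 0\<^sub>v n"
    and x: "\<And>k. x (Suc k) = A *\<^sub>v x k + B *\<^sub>v (cis (\<theta> * real k) \<cdot>\<^sub>v ws)"
  shows "x k = cis (\<theta> * real k) \<cdot>\<^sub>v (resolvent \<theta> *\<^sub>v (B *\<^sub>v ws)) - (A ^\<^sub>m k) *\<^sub>v (resolvent \<theta> *\<^sub>v (B *\<^sub>v ws))"
proof (induction k)
  define xs where "xs = resolvent \<theta> *\<^sub>v (B *\<^sub>v ws)"
  have xs: "xs \<in> carrier_vec n" unfolding xs_def
    using mult_mat_vec_carrier[OF resolvent_carrier mult_mat_vec_carrier[OF B ws]] .
  have Bws: "B *\<^sub>v ws \<in> carrier_vec n" using B ws by simp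
  {
    case 0
    show ?case unfolding xs_def[symmetric] using xs x0 by (simp add: cis_conv_exp)
  next
    case (Suc k)
    have Ak: "A ^\<^sub>m k \<in> carrier_mat n n" using A by simp
    have AA: "(A ^\<^sub>m Suc k) *\<^sub>v xs = A *\<^sub>v ((A ^\<^sub>m k) *\<^sub>v xs)"
    proof -
      have "A * A ^\<^sub>m k = A ^\<^sub>m k * A"
      proof (induction k)
        case (Suc k)
        have "A ^\<^sub>m k \<in> carrier_mat n n" using A by simp
        thus ?case using A Suc by (simp add: assoc_mult_mat[of A n n "A ^\<^sub>m k" n A n, symmetric])
      qed (use A in simp)
      hence "(A ^\<^sub>m Suc k) *\<^sub>v xs = (A * A ^\<^sub>m k) *\<^sub>v xs" by simp
      thus ?thesis using assoc_mult_mat_vec[OF A Ak xs] by simp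
    qed
    have steady: "A *\<^sub>v xs + B *\<^sub>v ws = cis \<theta> \<cdot>\<^sub>v xs"
      using steady_state_iff[OF xs ws] by (simp add: xs_def)
    let ?c = "cis (\<theta> * real k)" and ?y = "(A ^\<^sub>m k) *\<^sub>v xs"
    have y: "?y \<in> carrier_vec n" using Ak xs by simp
    have "x (Suc k) = A *\<^sub>v (?c \<cdot>\<^sub>v xs - ?y) + B *\<^sub>v (?c \<cdot>\<^sub>v ws)"
      using Suc.IH by (simp add: x xs_def)
    also have "\<dots> = (?c \<cdot>\<^sub>v (A *\<^sub>v xs) - A *\<^sub>v ?y) + ?c \<cdot>\<^sub>v (B *\<^sub>v ws)"
      using xs ws y Ak by (simp add: mult_mat_vec_minus mult_mat_vec_smult)
    also have "\<dots> = ?c \<cdot>\<^sub>v (A *\<^sub>v xs + B *\<^sub>v ws) - A *\<^sub>v ?y"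
      using xs ws y Bws A by (intro eq_vecI) (auto simp: algebra_simps)
    also have "?c \<cdot>\<^sub>v (A *\<^sub>v xs + B *\<^sub>v ws) = cis (\<theta> * real (Suc k)) \<cdot>\<^sub>v xs"
      by (simp add: steady smult_smult_assoc cis_mult algebra_simps)
    finally show ?case unfolding xs_def[symmetric] AA .
  }
qed

lemma mean_power_output:
  assumes ws: "ws \<in> carrier_vec m" and x0: "x 0 = 0\<^sub>v n"
    and w: "\<And>k. w k = cis (\<theta> * real k) \<cdot>\<^sub>v ws"
    and x: "\<And>k. x (Suc k) = A *\<^sub>v x k + B *\<^sub>v w k"
  shows "mean_power (sys_output C D w x) \<longlonglongrightarrow> norm_sq (transfer \<theta> *\<^sub>v ws)"
proof -
  define xs where "xs = resolvent \<theta> *\<^sub>v (B *\<^sub>v ws)"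
  have xs: "xs \<in> carrier_vec n" unfolding xs_def
    using mult_mat_vec_carrier[OF resolvent_carrier mult_mat_vec_carrier[OF B ws]] .
  define z where "z = transfer \<theta> *\<^sub>v ws"
  have z: "z \<in> carrier_vec l" unfolding z_def using mult_mat_vec_carrier[OF transfer_carrier ws] .
  define y where "y k = C *\<^sub>v ((A ^\<^sub>m k) *\<^sub>v xs)" for k
  have y: "y k \<in> carrier_vec l" for k by (intro carrier_vecI) (simp add: y_def)
  have out: "sys_output C D w x k = cis (\<theta> * real k) \<cdot>\<^sub>v z - y k" for k
  proof -
    let ?c = "cis (\<theta> * real k)"
    have Ak: "A ^\<^sub>m k \<in> carrier_mat n n" using A by simp
    have "x k = ?c \<cdot>\<^sub>v xs - (A ^\<^sub>m k) *\<^sub>v xs"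
      unfolding xs_def by (rule trajectory_closed_form[where x = x, OF ws x0]) (simp add: x w)
    hence "sys_output C D w x k = (?c \<cdot>\<^sub>v (C *\<^sub>v xs) - y k) + ?c \<cdot>\<^sub>v (D *\<^sub>v ws)"
      using xs ws Ak by (simp add: sys_output_def w y_def mult_mat_vec_minus mult_mat_vec_smult)
    also have "\<dots> = ?c \<cdot>\<^sub>v (C *\<^sub>v xs + D *\<^sub>v ws) - y k"
      using y[of k] by (intro eq_vecI) (auto simp: algebra_simps)
    also have "C *\<^sub>v xs + D *\<^sub>v ws = z" by (simp add: z_def xs_def transfer_mult_vec[OF ws])
    finally show ?thesis .
  qed
  obtain r c where r: "0 < r" "r < 1" and c: "0 \<le> c"
    and Ak: "\<And>k i j. i < n \<Longrightarrow> j < n \<Longrightarrow> cmod ((A ^\<^sub>m k) $$ (i, j)) \<le> c * r ^ k"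
    by (rule schur_stable_powers_decay[OF A n stable]) (rule that)
  define b where "b = (\<Sum>i<l. \<Sum>p<n. \<Sum>q<n. cmod (C $$ (i, p)) * c * cmod (xs $ q))"
  have b0: "0 \<le> b" unfolding b_def using c by (intro sum_nonneg mult_nonneg_nonneg) simp_all
  have yb: "cmod (y k $ i) \<le> b * r ^ k" if i: "i < l" for i k
  proof -
    have d: "dim_row (A ^\<^sub>m k) = n" "dim_col (A ^\<^sub>m k) = n" using pow_carrier_mat[OF A, of k] by auto
    have "y k $ i = (\<Sum>p<n. \<Sum>q<n. C $$ (i, p) * (A ^\<^sub>m k) $$ (p, q) * xs $ q)"
      using i d xs by (simp add: y_def scalar_prod_def atLeast0LessThan sum_distrib_left mult.assoc)
    also have "cmod \<dots> \<le> (\<Sum>p<n. \<Sum>q<n. cmod (C $$ (i, p) * (A ^\<^sub>m k) $$ (p, q) * xs $ q))"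
      by (rule order_trans[OF norm_sum]) (intro sum_mono norm_sum)
    also have "\<dots> \<le> (\<Sum>p<n. \<Sum>q<n. cmod (C $$ (i, p)) * c * cmod (xs $ q) * r ^ k)"
    proof (intro sum_mono)
      fix p q assume "p \<in> {..<n}" "q \<in> {..<n}"
      hence "cmod (C $$ (i, p)) * cmod ((A ^\<^sub>m k) $$ (p, q)) * cmod (xs $ q)
          \<le> cmod (C $$ (i, p)) * (c * r ^ k) * cmod (xs $ q)"
        by (intro mult_right_mono mult_left_mono Ak) auto
      thus "cmod (C $$ (i, p) * (A ^\<^sub>m k) $$ (p, q) * xs $ q) \<le> cmod (C $$ (i, p)) * c * cmod (xs $ q) * r ^ k"
        by (simp add: norm_mult mult_ac)
    qed
    also have "\<dots> = (\<Sum>p<n. \<Sum>q<n. cmod (C $$ (i, p)) * c * cmod (xs $ q)) * r ^ k"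
      by (simp add: sum_distrib_right)
    also have "\<dots> \<le> b * r ^ k" unfolding b_def
      using i c r by (intro mult_right_mono member_le_sum[of i "{..<l}"]) (auto intro!: sum_nonneg)
    finally show ?thesis .
  qed
  show ?thesis unfolding z_def[symmetric]
  proof (rule mean_power_tendsto[of r _ _ "(\<Sum>i<l. 2 * cmod (z $ i) + b) * b"])
    fix k
    have "\<bar>norm_sq (cis (\<theta> * real k) \<cdot>\<^sub>v z - y k) - norm_sq z\<bar> \<le> (\<Sum>i<l. 2 * cmod (z $ i) + b) * (b * r ^ k)"
    proof (rule norm_sq_perturbation[OF z y])
      have "r ^ k \<le> 1" using r by (intro power_le_one) auto
      thus "b * r ^ k \<le> b" using b0 mult_left_mono[of "r ^ k" 1 b] by simp
    qed (use b0 r yb in auto)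
    thus "\<bar>norm_sq (sys_output C D w x k) - norm_sq z\<bar> \<le> (\<Sum>i<l. 2 * cmod (z $ i) + b) * b * r ^ k"
      by (simp add: out mult.assoc)
  qed (use r in auto)
qed

end

lemma power_norm_exponential:
  assumes "\<And>k. w k = cis (\<theta> * real k) \<cdot>\<^sub>v ws"
  shows "power_norm w = sqrt (norm_sq ws)"
proof -
  have "mean_power w \<longlonglongrightarrow> norm_sq ws"
    by (rule mean_power_tendsto[of 0 _ _ 0]) (simp_all add: assms norm_sq_smult)
  thus ?thesis by (simp add: power_norm_def limI)
qed

lemma W_L_iff:
  "w \<in> W_L m \<theta>0 \<longleftrightarrow> (\<exists>\<theta>\<in>{-\<theta>0..\<theta>0}. \<exists>ws\<in>carrier_vec m. \<forall>k. w k = cis (\<theta> * real k) \<cdot>\<^sub>v ws)"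
  by (simp add: W_L_def cis_conv_exp mult_ac)

section \<open>The semidefinite program\<close>

lemma dim_append_cols [simp]:
  "dim_row (append_cols X Y) = dim_row X" "dim_col (append_cols X Y) = dim_col X + dim_col Y"
  by (simp_all add: append_cols_def)

lemma append_cols_carrier:
  assumes "X \<in> carrier_mat p n" "Y \<in> carrier_mat p m"
  shows "append_cols X Y \<in> carrier_mat p (n + m)"
  using assms by (intro carrier_matI) auto

lemma append_cols_mult_vec:
  assumes "X \<in> carrier_mat p n" "Y \<in> carrier_mat p m" "x \<in> carrier_vec n" "y \<in> carrier_vec m"
  shows "append_cols X Y *\<^sub>v (x @\<^sub>v y) = X *\<^sub>v x + Y *\<^sub>v y"
proof -
  have "append_cols X Y *\<^sub>v (x @\<^sub>v y) =
    (X *\<^sub>v x + Y *\<^sub>v y) @\<^sub>v (0\<^sub>m 0 n *\<^sub>v x + 0\<^sub>m 0 m *\<^sub>v y)"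
    unfolding append_cols_def using assms
    by (subst four_block_mat_mult_vec[of _ p n _ m _ 0]) auto
  thus ?thesis using assms by (intro eq_vecI) auto
qed

lemma append_cols_select:
  fixes x y :: "complex vec"
  assumes x: "x \<in> carrier_vec n" and y: "y \<in> carrier_vec m"
  shows "append_cols (1\<^sub>m n) (0\<^sub>m n m) *\<^sub>v (x @\<^sub>v y) = x"
    and "append_cols (0\<^sub>m m n) (1\<^sub>m m) *\<^sub>v (x @\<^sub>v y) = y"
proof -
  have "0\<^sub>m n m *\<^sub>v y = 0\<^sub>v n" "0\<^sub>m m n *\<^sub>v x = 0\<^sub>v m"
    using x y by (auto intro!: eq_vecI simp: scalar_prod_def)
  thus "append_cols (1\<^sub>m n) (0\<^sub>m n m) *\<^sub>v (x @\<^sub>v y) = x"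
    and "append_cols (0\<^sub>m m n) (1\<^sub>m m) *\<^sub>v (x @\<^sub>v y) = y"
    using append_cols_mult_vec[of "1\<^sub>m n" n n "0\<^sub>m n m" m x y]
      append_cols_mult_vec[of "0\<^sub>m m n" m n "1\<^sub>m m" m x y] x y by simp_all
qed

lemma mat_adjoint_append_cols:
  assumes "X \<in> carrier_mat p n" "Y \<in> carrier_mat p m"
  shows "mat_adjoint X @\<^sub>r mat_adjoint Y = mat_adjoint (append_cols X Y)"
  unfolding append_rows_def append_cols_def using assms
  by (subst mat_adjoint_four_block[of _ p n _ m _ 0]) auto

text \<open>The trace of a Gram matrix is the sum of the squared norms of its columns; this turns the
objective and the trace constraint into sums over the rank-one decomposition.\<close>

lemma trace_gram:
  fixes E L :: "complex mat"
  assumes "E \<in> carrier_mat p N" "L \<in> carrier_mat N q"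
  shows "Re (mat_trace (E * (L * mat_adjoint L) * mat_adjoint E)) = (\<Sum>i<q. norm_sq (E *\<^sub>v col L i))"
proof -
  note [simp] = carrier_matD[OF assms(1)] carrier_matD[OF assms(2)]
  have "E * (L * mat_adjoint L) * mat_adjoint E = (E * L) * mat_adjoint (E * L)"
    by (simp add: mult_mat_assoc mat_adjoint_mult)
  hence "mat_trace (E * (L * mat_adjoint L) * mat_adjoint E) =
      (\<Sum>k<p. \<Sum>i<q. (E * L) $$ (k, i) * cnj ((E * L) $$ (k, i)))"
    by (simp add: mat_trace_def scalar_prod_def atLeast0LessThan del: cnj_sum)
  also have "\<dots> = (\<Sum>i<q. \<Sum>k<p. (E * L) $$ (k, i) * cnj ((E * L) $$ (k, i)))" by (rule sum.swap)
  also have "\<dots> = (\<Sum>i<q. complex_of_real (norm_sq (E *\<^sub>v col L i)))"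
  proof (rule sum.cong[OF refl])
    fix i assume "i \<in> {..<q}"
    hence "col (E * L) i = E *\<^sub>v col L i" "i < q" using col_mult2[OF assms] by auto
    thus "(\<Sum>k<p. (E * L) $$ (k, i) * cnj ((E * L) $$ (k, i))) = complex_of_real (norm_sq (E *\<^sub>v col L i))"
      by (simp add: cscalar_prod_self[symmetric] scalar_prod_def atLeast0LessThan)
  qed
  finally show ?thesis by simp
qed

text \<open>The constraints involve \<open>V\<close> only through products \<open>P V Q\<^sup>*\<close> of the three matrices \<open>F = [A B]\<close>, \<open>G = [I 0]\<close>, \<open>H = [0 I]\<close>,
which extract the next state, the state and the input.\<close>

lemma sdp_feasible_iff:
  assumes A: "A \<in> carrier_mat n n" and B: "B \<in> carrier_mat n m"
  defines "F \<equiv> append_cols A B" and "G \<equiv> append_cols (1\<^sub>m n) (0\<^sub>m n m)"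
    and "H \<equiv> append_cols (0\<^sub>m m n) (1\<^sub>m m)"
  shows "sdp_feasible n m A B \<theta>0 V \<longleftrightarrow>
     V \<in> carrier_mat (n + m) (n + m) \<and> psd V \<and>
     G * V * mat_adjoint G = F * V * mat_adjoint F \<and>
     Re (mat_trace (H * V * mat_adjoint H)) \<le> 1 \<and>
     loewner_le (complex_of_real (2 * cos \<theta>0) \<cdot>\<^sub>m (G * V * mat_adjoint G))
                    (F * V * mat_adjoint G + G * V * mat_adjoint F)"
proof -
  have 1: "mat_adjoint A @\<^sub>r mat_adjoint B = mat_adjoint F"
    unfolding F_def by (rule mat_adjoint_append_cols[OF A B])
  have 2: "1\<^sub>m n @\<^sub>r 0\<^sub>m m n = mat_adjoint G"
    unfolding G_def using mat_adjoint_append_cols[of "1\<^sub>m n" n n "0\<^sub>m n m" m] by simp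
  have "psd V \<Longrightarrow> hermitian V" by (simp add: psd_def)
  thus ?thesis unfolding sdp_feasible_def Let_def 1 2 F_def[symmetric] G_def[symmetric] H_def[symmetric]
    by blast
qed

context stable_system
begin

text \<open>In each column \<open>(x, w)\<close> of the decomposition, \<open>x\<close> is the steady state for the input \<open>w\<close> at some
frequency in the enlarged arc, so the output has squared norm at most \<open>c |w|\<^sup>2\<close>.\<close>

lemma sdp_objective_le:
  assumes V: "sdp_feasible n m A B \<theta>0 V" and \<theta>: "0 < \<theta>0" "\<theta>0 < \<theta>" "\<theta> < pi"
    and gain: "\<And>\<phi> w. \<phi> \<in> {-\<theta>..\<theta>} \<Longrightarrow> w \<in> carrier_vec m \<Longrightarrow> norm_sq (transfer \<phi> *\<^sub>v w) \<le> c * norm_sq w"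
    and c: "0 \<le> c"
  shows "sdp_objective C D V \<le> c"
proof -
  define F where "F = append_cols A B"
  define G where "G = append_cols (1\<^sub>m n) (0\<^sub>m n m :: complex mat)"
  define H where "H = append_cols (0\<^sub>m m n) (1\<^sub>m m :: complex mat)"
  define E where "E = append_cols C D"
  have Fc: "F \<in> carrier_mat n (n + m)" and Gc: "G \<in> carrier_mat n (n + m)"
    and Hc: "H \<in> carrier_mat m (n + m)" and Ec: "E \<in> carrier_mat l (n + m)"
    using append_cols_carrier[OF A B] append_cols_carrier[OF C D] 
    by (auto simp: F_def G_def H_def E_def intro!: append_cols_carrier)
  note feas = V[unfolded sdp_feasible_iff[OF A B], folded F_def G_def H_def]
  obtain L where L: "L \<in> carrier_mat (n + m) (n + m)" and VL: "V = L * mat_adjoint L"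
    and cols: "\<And>i. i < n + m \<Longrightarrow> \<exists>\<phi>\<in>{-\<theta>..\<theta>}. F *\<^sub>v col L i = cis \<phi> \<cdot>\<^sub>v (G *\<^sub>v col L i)"
    using psd_rank_one_decomposition[OF Fc Gc _ _ _ _ \<theta>, of V] feas by metis
  have le: "norm_sq (E *\<^sub>v col L i) \<le> c * norm_sq (H *\<^sub>v col L i)" if i: "i < n + m" for i
  proof -
    obtain \<phi> where \<phi>: "\<phi> \<in> {-\<theta>..\<theta>}" and e: "F *\<^sub>v col L i = cis \<phi> \<cdot>\<^sub>v (G *\<^sub>v col L i)"
      using cols[OF i] by auto
    define x where "x = vec_first (col L i) n"
    define w where "w = vec_last (col L i) m"
    have x: "x \<in> carrier_vec n" and w: "w \<in> carrier_vec m" by (simp_all add: x_def w_def)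
    have Li: "col L i = x @\<^sub>v w"
      unfolding x_def w_def by (rule vec_first_last_append[symmetric]) (use L in \<open>auto intro: carrier_vecI\<close>)
    have "F *\<^sub>v col L i = A *\<^sub>v x + B *\<^sub>v w" unfolding F_def Li by (rule append_cols_mult_vec[OF A B x w])
    moreover have "G *\<^sub>v col L i = x"
      unfolding G_def Li by (rule append_cols_select(1)[OF x w])
    ultimately have "A *\<^sub>v x + B *\<^sub>v w = cis \<phi> \<cdot>\<^sub>v x" using e by simp
    hence "x = resolvent \<phi> *\<^sub>v (B *\<^sub>v w)" using steady_state_iff[OF x w] by blast
    hence "E *\<^sub>v col L i = transfer \<phi> *\<^sub>v w"
      unfolding E_def Li append_cols_mult_vec[OF C D x w] transfer_mult_vec[OF w] by (rule arg_cong[where f = "\<lambda>y. C *\<^sub>v y + D *\<^sub>v w"])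
    moreover have "H *\<^sub>v col L i = w"
      unfolding H_def Li by (rule append_cols_select(2)[OF x w])
    ultimately show ?thesis using gain[OF \<phi> w] by simp
  qed
  have "sdp_objective C D V = (\<Sum>i<n + m. norm_sq (E *\<^sub>v col L i))"
    unfolding sdp_objective_def E_def[symmetric] VL by (rule trace_gram[OF Ec L])
  also have "\<dots> \<le> (\<Sum>i<n + m. c * norm_sq (H *\<^sub>v col L i))" by (intro sum_mono le) auto
  also have "\<dots> = c * Re (mat_trace (H * V * mat_adjoint H))"
    unfolding VL trace_gram[OF Hc L] by (simp add: sum_distrib_left)
  also have "\<dots> \<le> c * 1" using feas c by (intro mult_left_mono) auto
  finally show ?thesis by simp
qed

text \<open>For \<open>V = v v\<^sup>*\<close> with \<open>v = (x, w\<^sub>s)\<close> and \<open>x\<close> the steady state at frequency \<open>\<theta>\<close>, both sides of the equality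
constraint are \<open>x x\<^sup>*\<close>, and the last constraint says \<open>2 cos \<theta>0 x x\<^sup>* \<preceq> 2 cos \<theta> x x\<^sup>*\<close>.\<close>

lemma sdp_feasible_rank_one:
  assumes ws: "ws \<in> carrier_vec m" "norm_sq ws \<le> 1" and \<theta>: "\<theta> \<in> {-\<theta>0..\<theta>0}" "\<theta>0 < pi"
  obtains V where "sdp_feasible n m A B \<theta>0 V" "sdp_objective C D V = norm_sq (transfer \<theta> *\<^sub>v ws)"
proof -
  define F where "F = append_cols A B"
  define G where "G = append_cols (1\<^sub>m n) (0\<^sub>m n m :: complex mat)"
  define H where "H = append_cols (0\<^sub>m m n) (1\<^sub>m m :: complex mat)"
  define E where "E = append_cols C D"
  have Fc: "F \<in> carrier_mat n (n + m)" and Gc: "G \<in> carrier_mat n (n + m)"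
    and Hc: "H \<in> carrier_mat m (n + m)" and Ec: "E \<in> carrier_mat l (n + m)"
    using append_cols_carrier[OF A B] append_cols_carrier[OF C D]
    by (auto simp: F_def G_def H_def E_def intro!: append_cols_carrier)
  define x where "x = resolvent \<theta> *\<^sub>v (B *\<^sub>v ws)"
  have x: "x \<in> carrier_vec n" unfolding x_def
    using mult_mat_vec_carrier[OF resolvent_carrier mult_mat_vec_carrier[OF B ws(1)]] .
  define L where "L = mat_of_cols (n + m) [x @\<^sub>v ws]"
  have L: "L \<in> carrier_mat (n + m) 1" unfolding L_def using mat_of_cols_carrier(1)[of "n + m" "[x @\<^sub>v ws]"] by simp
  note [simp] = carrier_matD[OF Fc] carrier_matD[OF Gc] carrier_matD[OF Hc] carrier_matD[OF L]
  have L0: "col L 0 = x @\<^sub>v ws" unfolding L_def using x ws by (subst col_mat_of_cols) auto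
  have FL: "F *\<^sub>v col L 0 = cis \<theta> \<cdot>\<^sub>v x"
    unfolding F_def L0 append_cols_mult_vec[OF A B x ws(1)]
    using steady_state_iff[OF x ws(1)] x_def by blast
  have GL: "G *\<^sub>v col L 0 = x"
    unfolding G_def L0 by (rule append_cols_select(1)[OF x ws(1)])
  have HL: "H *\<^sub>v col L 0 = ws"
    unfolding H_def L0 by (rule append_cols_select(2)[OF x ws(1)])
  have EL: "E *\<^sub>v col L 0 = transfer \<theta> *\<^sub>v ws"
    unfolding E_def L0 append_cols_mult_vec[OF C D x ws(1)] transfer_mult_vec[OF ws(1)] by (simp add: x_def)
  define V where "V = L * mat_adjoint L"
  have V: "V \<in> carrier_mat (n + m) (n + m)" by (intro carrier_matI) (simp_all add: V_def)
  have psdV: "psd V" unfolding V_def by (rule psd_gram[OF L])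
  define X where "X = G * L"
  have X: "X \<in> carrier_mat n 1" by (intro carrier_matI) (simp_all add: X_def)
  have FX: "F * L = cis \<theta> \<cdot>\<^sub>m X"
  proof (rule eq_matI)
    fix i j assume "i < dim_row (cis \<theta> \<cdot>\<^sub>m X)" "j < dim_col (cis \<theta> \<cdot>\<^sub>m X)"
    hence ij: "i < n" "j = 0" using X by auto
    have "(F * L) $$ (i, j) = (F *\<^sub>v col L 0) $ i" using ij by simp
    also have "\<dots> = cis \<theta> * (G *\<^sub>v col L 0) $ i" unfolding FL GL using ij x by simp
    also have "\<dots> = (cis \<theta> \<cdot>\<^sub>m X) $$ (i, j)" using ij by (simp add: X_def)
    finally show "(F * L) $$ (i, j) = (cis \<theta> \<cdot>\<^sub>m X) $$ (i, j)" .
  qed (use X in simp_all)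
  have gram: "P * V * mat_adjoint Q = (P * L) * mat_adjoint (Q * L)"
    if "dim_col P = n + m" "dim_col Q = n + m" for P Q
    using that by (simp add: V_def mult_mat_assoc mat_adjoint_mult)
  have Xe: "(c \<cdot>\<^sub>m X) * mat_adjoint (d \<cdot>\<^sub>m X) = (c * cnj d) \<cdot>\<^sub>m (X * mat_adjoint X)" for c d
    using X by (intro eq_matI) (auto simp: scalar_prod_def)
  have X1: "1 \<cdot>\<^sub>m X = X" by (intro eq_matI) auto
  have GG: "G * V * mat_adjoint G = X * mat_adjoint X" by (simp add: gram X_def)
  have FF: "F * V * mat_adjoint F = X * mat_adjoint X"
    by (simp add: gram FX Xe cis_cnj cis_mult) (intro eq_matI; simp)
  have FG: "F * V * mat_adjoint G = cis \<theta> \<cdot>\<^sub>m (X * mat_adjoint X)"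
    using Xe[of "cis \<theta>" 1] by (simp add: gram FX X_def[symmetric] X1)
  have GF: "G * V * mat_adjoint F = cnj (cis \<theta>) \<cdot>\<^sub>m (X * mat_adjoint X)"
    using Xe[of 1 "cis \<theta>"] by (simp add: gram FX X_def[symmetric] X1)
  have tr: "Re (mat_trace (H * V * mat_adjoint H)) \<le> 1"
    unfolding V_def trace_gram[OF Hc L] by (simp add: HL ws)
  have "loewner_le (complex_of_real (2 * cos \<theta>0) \<cdot>\<^sub>m (X * mat_adjoint X))
     (cis \<theta> \<cdot>\<^sub>m (X * mat_adjoint X) + cnj (cis \<theta>) \<cdot>\<^sub>m (X * mat_adjoint X))"
  proof -
    define d where "d = 2 * (cos \<theta> - cos \<theta>0)"
    have "cos \<theta>0 \<le> cos \<bar>\<theta>\<bar>" using \<theta> by (intro cos_monotone_0_pi_le) auto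
    hence d: "0 \<le> d" by (simp add: d_def)
    have "cis \<theta> \<cdot>\<^sub>m (X * mat_adjoint X) + cnj (cis \<theta>) \<cdot>\<^sub>m (X * mat_adjoint X)
        - complex_of_real (2 * cos \<theta>0) \<cdot>\<^sub>m (X * mat_adjoint X) = complex_of_real d \<cdot>\<^sub>m (X * mat_adjoint X)"
    proof -
      have "cis \<theta> + cnj (cis \<theta>) - complex_of_real (2 * cos \<theta>0) = complex_of_real d"
        by (simp add: d_def complex_eq_iff)
      thus ?thesis by (intro eq_matI) (auto simp: ring_distribs[symmetric] left_diff_distrib[symmetric] simp del: index_mult_mat(1))
    qed
    also have "\<dots> = (complex_of_real (sqrt d) \<cdot>\<^sub>m X) * mat_adjoint (complex_of_real (sqrt d) \<cdot>\<^sub>m X)"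
      unfolding Xe using d by (simp add: of_real_mult[symmetric] del: of_real_mult)
    finally show ?thesis
      using psd_gram[of "complex_of_real (sqrt d) \<cdot>\<^sub>m X" n 1] X by (simp add: loewner_le_def)
  qed
  hence "sdp_feasible n m A B \<theta>0 V"
    unfolding sdp_feasible_iff[OF A B] F_def[symmetric] G_def[symmetric] H_def[symmetric]
    using V psdV tr by (simp only: GG FF FG GF) 
  moreover have "sdp_objective C D V = norm_sq (transfer \<theta> *\<^sub>v ws)"
    unfolding sdp_objective_def E_def[symmetric] V_def trace_gram[OF Ec L] by (simp add: EL)
  ultimately show ?thesis using that by blast
qed

lemma traj_feasible_objective:
  assumes "traj_feasible n m A B \<theta>0 (w, x)"
  obtains \<theta> ws where "\<theta> \<in> {-\<theta>0..\<theta>0}" "ws \<in> carrier_vec m" "norm_sq ws \<le> 1"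
    "mean_power (sys_output C D w x) \<longlonglongrightarrow> norm_sq (transfer \<theta> *\<^sub>v ws)"
proof -
  obtain \<theta> ws where \<theta>: "\<theta> \<in> {-\<theta>0..\<theta>0}" and ws: "ws \<in> carrier_vec m"
    and w: "\<And>k. w k = cis (\<theta> * real k) \<cdot>\<^sub>v ws"
    using assms by (auto simp: traj_feasible_def W_L_iff)
  have "norm_sq ws \<le> 1"
    using assms power_norm_exponential[OF w] by (simp add: traj_feasible_def)
  moreover have "mean_power (sys_output C D w x) \<longlonglongrightarrow> norm_sq (transfer \<theta> *\<^sub>v ws)"
    using assms by (intro mean_power_output[OF ws _ w]) (auto simp: traj_feasible_def)
  ultimately show ?thesis using that \<theta> ws by blast
qed

lemma traj_feasible_exponential:
  assumes \<theta>: "\<theta> \<in> {-\<theta>0..\<theta>0}" and ws: "ws \<in> carrier_vec m" "norm_sq ws \<le> 1"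
  obtains w x where "traj_feasible n m A B \<theta>0 (w, x)"
    "traj_objective C D (w, x) = norm_sq (transfer \<theta> *\<^sub>v ws)"
proof -
  define w where "w k = cis (\<theta> * real k) \<cdot>\<^sub>v ws" for k
  define x where "x = rec_nat (0\<^sub>v n) (\<lambda>k y. A *\<^sub>v y + B *\<^sub>v w k)"
  have x: "x 0 = 0\<^sub>v n" "\<And>k. x (Suc k) = A *\<^sub>v x k + B *\<^sub>v w k" by (simp_all add: x_def)
  have wc: "w k \<in> carrier_vec m" for k using ws by (simp add: w_def)
  have xc: "x k \<in> carrier_vec n" for k by (cases k) (auto simp: x intro: carrier_vecI)
  have "power_norm w \<le> 1" using power_norm_exponential[OF w_def] ws by simp
  moreover have "w \<in> W_L m \<theta>0" using \<theta> ws w_def by (auto simp: W_L_iff)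
  ultimately have "traj_feasible n m A B \<theta>0 (w, x)" using x wc xc by (simp add: traj_feasible_def)
  moreover have "traj_objective C D (w, x) = norm_sq (transfer \<theta> *\<^sub>v ws)"
    using limI[OF mean_power_output[OF ws(1) x(1) w_def x(2)]] by (simp add: traj_objective_def)
  ultimately show ?thesis using that by blast
qed

end

section \<open>Equality of the optimal values\<close>

theorem proposition5:
  fixes A B C D :: "complex mat" and n m l :: nat and \<theta>0 :: real
  assumes "n \<ge> 1" and "m \<ge> 1" and "l \<ge> 1"
    and "A \<in> carrier_mat n n" and "B \<in> carrier_mat n m"
    and "C \<in> carrier_mat l n" and "D \<in> carrier_mat l m"
    and "schur_stable A"
    and "0 < \<theta>0" and "\<theta>0 < pi"
  shows "(\<forall>w x. traj_feasible n m A B \<theta>0 (w, x) \<longrightarrow> convergent (mean_power (sys_output C D w x))) \<and>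
    (\<exists>V w x. is_arg_max (sdp_objective C D) (sdp_feasible n m A B \<theta>0) V \<and>
             is_arg_max (traj_objective C D) (traj_feasible n m A B \<theta>0) (w, x) \<and>
             sdp_objective C D V = traj_objective C D (w, x))"
proof -
  interpret stable_system A B C D n m l
    using assms by unfold_locales auto
  obtain \<mu> u where u: "\<And>t. u t \<in> carrier_vec m" "\<And>t. norm_sq (u t) = 1"
    and u_gain: "\<And>t. norm_sq (transfer t *\<^sub>v u t) = \<mu> t"
    and gain: "\<And>t w. w \<in> carrier_vec m \<Longrightarrow> norm_sq (transfer t *\<^sub>v w) \<le> \<mu> t * norm_sq w"
    and cont: "\<And>t. isCont \<mu> t"
    using continuous_max_gain[OF continuous_transfer assms(2)] by metis
  have \<mu>_nonneg: "0 \<le> \<mu> t" for t using u_gain[of t, symmetric] by simp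
  obtain \<theta> where \<theta>: "\<theta> \<in> {-\<theta>0..\<theta>0}" and max: "\<And>t. t \<in> {-\<theta>0..\<theta>0} \<Longrightarrow> \<mu> t \<le> \<mu> \<theta>"
    using isCont_eq_Ub[of "-\<theta>0" \<theta>0 \<mu>] cont assms(9) by (auto; blast)
  have traj_le: "traj_objective C D (w, x) \<le> \<mu> \<theta>" if feas: "traj_feasible n m A B \<theta>0 (w, x)" for w x
  proof -
    obtain t ws where t: "t \<in> {-\<theta>0..\<theta>0}" "ws \<in> carrier_vec m" "norm_sq ws \<le> 1"
      "mean_power (sys_output C D w x) \<longlonglongrightarrow> norm_sq (transfer t *\<^sub>v ws)"
      using traj_feasible_objective[OF feas] .
    have "traj_objective C D (w, x) = norm_sq (transfer t *\<^sub>v ws)"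
      using limI[OF t(4)] by (simp add: traj_objective_def)
    also have "\<dots> \<le> \<mu> t * norm_sq ws" by (rule gain[OF t(2)])
    also have "\<dots> \<le> \<mu> t * 1" using t(3) \<mu>_nonneg by (intro mult_left_mono) auto
    also have "\<dots> \<le> \<mu> \<theta>" using max[OF t(1)] by simp
    finally show ?thesis .
  qed
  have sdp_le: "sdp_objective C D V \<le> \<mu> \<theta>" if feas: "sdp_feasible n m A B \<theta>0 V" for V
  proof (rule field_le_epsilon)
    fix e :: real assume e: "0 < e"
    have "\<mu> t < \<mu> \<theta> + e" if "t \<in> {-\<theta>0..\<theta>0}" for t using max[OF that] e by simp
    \<comment> \<open>By continuity the gain stays below \<open>\<mu> \<theta> + e\<close> on a slightly larger interval, as the rank-one
      decomposition requires.\<close>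
    from strict_bound_enlarged_interval[OF cont this assms(9,10)]
    obtain a where a: "\<theta>0 < a" "a < pi" "\<And>t. t \<in> {-a..a} \<Longrightarrow> \<mu> t < \<mu> \<theta> + e" by blast
    show "sdp_objective C D V \<le> \<mu> \<theta> + e"
    proof (rule sdp_objective_le[OF feas assms(9) a(1,2)])
      fix t :: real and w :: "complex vec" assume tw: "t \<in> {-a..a}" "w \<in> carrier_vec m"
      have "norm_sq (transfer t *\<^sub>v w) \<le> \<mu> t * norm_sq w" by (rule gain[OF tw(2)])
      also have "\<dots> \<le> (\<mu> \<theta> + e) * norm_sq w" using a(3)[OF tw(1)] by (intro mult_right_mono) auto
      finally show "norm_sq (transfer t *\<^sub>v w) \<le> (\<mu> \<theta> + e) * norm_sq w" .
    qed (use e \<mu>_nonneg[of \<theta>] in simp)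
  qed
  obtain V where V: "sdp_feasible n m A B \<theta>0 V" "sdp_objective C D V = \<mu> \<theta>"
    using sdp_feasible_rank_one[OF u(1) _ \<theta> assms(10), of \<theta>] u(2) u_gain by auto
  obtain w x where wx: "traj_feasible n m A B \<theta>0 (w, x)" "traj_objective C D (w, x) = \<mu> \<theta>"
    using traj_feasible_exponential[OF \<theta> u(1)[of \<theta>]] u(2) u_gain by auto
  have "is_arg_max (sdp_objective C D) (sdp_feasible n m A B \<theta>0) V"
    using V sdp_le by (auto simp: is_arg_max_def not_less)
  moreover have "is_arg_max (traj_objective C D) (traj_feasible n m A B \<theta>0) (w, x)"
    using wx traj_le by (auto simp: is_arg_max_def not_less)
  moreover have "convergent (mean_power (sys_output C D w x))" if "traj_feasible n m A B \<theta>0 (w, x)" for w x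
    using traj_feasible_objective[OF that] by (auto simp: convergent_def)
  ultimately show ?thesis using V(2) wx(2) by metis
qed

end
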